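(* Let $X$ be a max-stable random sup-measure on $E$ with tail dependence functional $\ell$, and let $$\mathbf M=\Big\{\mu\ \text{Radon measure on } E:\ \int f\,d\mu\le\ell(f)\ \text{for all } f\in\mathrm{USC}\Big\}.$$ Then $\mathbf M$ is convex and $$\ell(f)=\sup_{\mu\in\mathbf M}\int f\,d\mu\qquad\text{for all } f\in\mathrm{USC}.$$
   Context: $E$ is a locally compact Hausdorff second countable space; $\mathcal K$ its compact subsets. A sup-measure on $E$ is a Choquet capacity $\varphi$ (non-decreasing, $\varphi(\emptyset)=0$, $\varphi(A_n)\uparrow\varphi(A)$ if $A_n\uparrow A$, $\varphi(K_n)\downarrow\varphi(K)$ for compact $K_n\downarrow K$), finite on compacts, with $\varphi(\bigcup_j G_j)=\sup_j\varphi(G_j)$ for all families of open sets; a random sup-measure is a random element of the space of sup-measures (Borel $\sigma$-algebra of the sup-vague topology). $\mathrm{USC}$: bounded non-negative upper semicontinuous functions on $E$ with relatively compact support. Extremal integral $\int^e f\,d\varphi=\sup\{\varphi(K)\inf_{x\in K}f(x):K\in\mathcal K\}$. Unit Fréchet with scale $a\ge0$: distribution function $\exp(-a/t)$, $t>0$. $X$ is max-stable if $\bigvee_iu_iX(K_i)$ is unit Fréchet for all $K_1,\dots,K_m\in\mathcal K$, $u_i\ge0$; tail dependence functional $\ell(f)$ = scale parameter of $\int^e f\,dX$. *)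

theory Defs
  imports "HOL-Analysis.Analysis" "HOL-Probability.Probability"
begin

definition sup_measure :: "('a::topological_space set \<Rightarrow> ennreal) \<Rightarrow> bool" where
  "sup_measure \<phi> \<longleftrightarrow>
     (\<forall>A B. A \<subseteq> B \<longrightarrow> \<phi> A \<le> \<phi> B) \<and>
     \<phi> {} = 0 \<and>
     (\<forall>A :: nat \<Rightarrow> 'a set. incseq A \<longrightarrow> (\<lambda>n. \<phi> (A n)) \<longlonglongrightarrow> \<phi> (\<Union>n. A n)) \<and>
     (\<forall>K :: nat \<Rightarrow> 'a set. (\<forall>n. compact (K n)) \<and> decseq K \<longrightarrow>
         (\<lambda>n. \<phi> (K n)) \<longlonglongrightarrow> \<phi> (\<Inter>n. K n)) \<and>
     (\<forall>K. compact K \<longrightarrow> \<phi> K < \<infinity>) \<and>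
     (\<forall>\<G>. (\<forall>G\<in>\<G>. open G) \<longrightarrow> \<phi> (\<Union>\<G>) = (SUP G\<in>\<G>. \<phi> G))"

definition sup_measures :: "('a::topological_space set \<Rightarrow> ennreal) set" where
  "sup_measures = {\<phi>. sup_measure \<phi>}"

definition sup_vague_topology :: "('a::topological_space set \<Rightarrow> ennreal) topology" where
  "sup_vague_topology = topology_generated_by
     ({sup_measures} \<union>
      {{\<phi>\<in>sup_measures. \<phi> K < ennreal x} | K x. compact K \<and> x > 0} \<union>
      {{\<phi>\<in>sup_measures. \<phi> G > ennreal x} | G x. open G \<and> x > 0})"

definition sup_vague_borel :: "('a::topological_space set \<Rightarrow> ennreal) measure" where
  "sup_vague_borel = sigma (topspace sup_vague_topology) {U. openin sup_vague_topology U}"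

definition random_sup_measure :: "'w measure \<Rightarrow> ('w \<Rightarrow> 'a::topological_space set \<Rightarrow> ennreal) \<Rightarrow> bool" where
  "random_sup_measure P X \<longleftrightarrow> prob_space P \<and> X \<in> measurable P sup_vague_borel"

definition frechet_scale :: "'w measure \<Rightarrow> ('w \<Rightarrow> ennreal) \<Rightarrow> real \<Rightarrow> bool" where
  "frechet_scale P Y a \<longleftrightarrow> a \<ge> 0 \<and>
     (\<forall>t::real. t > 0 \<longrightarrow> measure P {\<omega>\<in>space P. Y \<omega> \<le> ennreal t} = exp (- a / t))"

definition unit_frechet :: "'w measure \<Rightarrow> ('w \<Rightarrow> ennreal) \<Rightarrow> bool" where
  "unit_frechet P Y \<longleftrightarrow> (\<exists>a. frechet_scale P Y a)"

definition max_stable :: "'w measure \<Rightarrow> ('w \<Rightarrow> 'a::topological_space set \<Rightarrow> ennreal) \<Rightarrow> bool" where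
  "max_stable P X \<longleftrightarrow>
     (\<forall>(m::nat) (K::nat \<Rightarrow> 'a set) (u::nat \<Rightarrow> real).
        (\<forall>i<m. compact (K i) \<and> u i \<ge> 0) \<longrightarrow>
        unit_frechet P (\<lambda>\<omega>. SUP i\<in>{..<m}. ennreal (u i) * X \<omega> (K i)))"

definition USC :: "('a::topological_space \<Rightarrow> real) set" where
  "USC = {f. bounded (range f) \<and> (\<forall>x. f x \<ge> 0) \<and>
              (\<forall>t. open {x. f x < t}) \<and> compact (closure {x. f x \<noteq> 0})}"

definition extremal_integral :: "('a::topological_space \<Rightarrow> real) \<Rightarrow> ('a set \<Rightarrow> ennreal) \<Rightarrow> ennreal" where
  "extremal_integral f \<phi> = (SUP K\<in>{K. compact K}. \<phi> K * (INF x\<in>K. ennreal (f x)))"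

definition tail_dependence :: "'w measure \<Rightarrow> ('w \<Rightarrow> 'a::topological_space set \<Rightarrow> ennreal) \<Rightarrow> ('a \<Rightarrow> real) \<Rightarrow> real" where
  "tail_dependence P X f = (THE a. frechet_scale P (\<lambda>\<omega>. extremal_integral f (X \<omega>)) a)"

text \<open>Radon measures on E (E locally compact Hausdorff second countable):
  Borel measures finite on compact sets.\<close>
definition radon_measure :: "'a::topological_space measure \<Rightarrow> bool" where
  "radon_measure \<mu> \<longleftrightarrow> sets \<mu> = sets borel \<and> (\<forall>K. compact K \<longrightarrow> emeasure \<mu> K < \<infinity>)"

definition convex_comb_measure :: "real \<Rightarrow> 'a::topological_space measure \<Rightarrow> 'a measure \<Rightarrow> 'a measure" where
  "convex_comb_measure t \<mu> \<nu> = measure_of UNIV (sets borel)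
     (\<lambda>A. ennreal t * emeasure \<mu> A + ennreal (1 - t) * emeasure \<nu> A)"

end

theory Submission
  imports Defs
begin

text \<open>Put \<open>h x = \<phi> {x}\<close>. For a sup-measure \<open>\<phi>\<close> on a locally compact space \<open>h\<close> is upper
  semicontinuous and the extremal integral of \<open>f\<close> is \<open>SUP x. f x * h x\<close>. Since \<open>E[Y powr p]\<close> is a
  constant multiple of \<open>a powr p\<close> for a unit Frechet variable \<open>Y\<close> of scale \<open>a\<close> and \<open>0 < p < 1\<close>,
  subadditivity of \<open>t \<mapsto> t powr p\<close> gives \<open>\<ell>(f + g) powr p \<le> \<ell>(f) powr p + \<ell>(g) powr p\<close>, and \<open>p \<rightarrow> 1\<close>
  gives subadditivity of \<open>\<ell>\<close>.

  No Hahn-Banach or Riesz theorem is needed to find a measure dominated by \<open>\<ell>\<close> and attaining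
  \<open>\<ell>(f)\<close>: let \<open>s\<close> be a measurable selection of a maximiser of \<open>f * h\<close> and \<open>M\<close> the maximum. The
  derivative of \<open>e \<mapsto> E[sqrt (M + e * (g s * h s))]\<close> at \<open>e = 0\<close> is linear in \<open>g\<close>, and after
  normalisation it is the integral of \<open>g\<close> against such a measure.\<close>

section \<open>Sup-measures and extremal integrals\<close>

text \<open>Cantor's intersection theorem: with empty intersection the complements cover
  \<open>C 0\<close>, and by monotonicity a finite subcover misses the whole nonempty set
  \<open>C N\<close>.\<close>

lemma nested_compact_nonempty:
  fixes C :: "nat \<Rightarrow> 'a::t2_space set"
  assumes "\<And>n. compact (C n)" "\<And>n. C n \<noteq> {}" "decseq C"
  shows "(\<Inter>n. C n) \<noteq> {}"
proof
  assume empty: "(\<Inter>n. C n) = {}"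
  have "C 0 \<subseteq> (\<Union>n\<in>UNIV. - C n)" using empty by auto
  moreover have "open (- C n)" for n
    using assms(1) compact_imp_closed by (auto simp: open_closed[symmetric] closed_def)
  ultimately obtain D where D: "finite D" "C 0 \<subseteq> (\<Union>n\<in>D. - C n)"
    using compactE_image[OF assms(1), of UNIV "\<lambda>n. - C n" 0] by (metis subset_UNIV)
  define N where "N = Max (insert 0 D)"
  have "C N \<subseteq> C n" if "n \<in> D \<or> n = 0" for n
  proof -
    have "n \<le> N" using D(1) that unfolding N_def by auto
    then show ?thesis using assms(3) by (simp add: decseq_def)
  qed
  then show False
    using D(2) assms(2)[of N] by blast
qed

lemma sup_measure_mono: "sup_measure \<phi> \<Longrightarrow> A \<subseteq> B \<Longrightarrow> \<phi> A \<le> \<phi> B"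
  by (simp add: sup_measure_def)

lemma sup_measure_compact_finite: "sup_measure \<phi> \<Longrightarrow> compact K \<Longrightarrow> \<phi> K < \<infinity>"
  by (simp add: sup_measure_def)

lemma sup_measure_Union_open:
  "sup_measure \<phi> \<Longrightarrow> (\<And>G. G \<in> \<G> \<Longrightarrow> open G) \<Longrightarrow> \<phi> (\<Union>\<G>) = (SUP G\<in>\<G>. \<phi> G)"
  by (simp add: sup_measure_def)

text \<open>Closures of a countable neighbourhood base, cut by a compact neighbourhood, are compact
  sets decreasing to \<open>{x}\<close>, so continuity along decreasing compacts applies. This
  yields upper semicontinuity of \<open>x \<mapsto> \<phi> {x}\<close>.\<close>

lemma sup_measure_outer_point:
  fixes \<phi> :: "'a::{t2_space, second_countable_topology} set \<Rightarrow> ennreal"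
  assumes lc: "locally_compact_space (euclidean :: 'a topology)"
    and \<phi>: "sup_measure \<phi>" and t: "\<phi> {x} < t"
  shows "\<exists>G. open G \<and> x \<in> G \<and> \<phi> G < t"
proof -
  obtain U K where UK: "open U" "compact K" "x \<in> U" "U \<subseteq> K"
    using lc unfolding locally_compact_space_def by simp blast
  obtain A :: "nat \<Rightarrow> 'a set" where A: "\<And>i. x \<in> A i" "\<And>i. open (A i)"
    "\<And>S. open S \<Longrightarrow> x \<in> S \<Longrightarrow> \<exists>i. A i \<subseteq> S"
    using first_countable_basis[of x] by auto
  define C where "C n = K \<inter> (\<Inter>i\<le>n. closure (A i))" for n
  have C: "compact (C n)" for n
    unfolding C_def using UK(2) by (intro compact_Int_closed) auto
  have dec: "decseq C" unfolding C_def decseq_def by force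
  have "(\<Inter>n. C n) = {x}"
  proof safe
    fix y assume y: "y \<in> (\<Inter>n. C n)"
    show "y = x"
    proof (rule ccontr)
      assume "y \<noteq> x"
      then obtain V W where VW: "open V" "open W" "x \<in> V" "y \<in> W" "V \<inter> W = {}"
        using hausdorff[of x y] by metis
      \<comment> \<open>A basic set inside \<open>V\<close> is disjoint from the open set
        \<open>W\<close>, hence so is its closure; this removes \<open>y\<close>.\<close>
      obtain i where "A i \<subseteq> V" using A(3) VW by blast
      then have "A i \<inter> W = {}" using VW by blast
      then have "closure (A i) \<inter> W = {}" using VW(2) open_Int_closure_eq_empty by blast
      moreover have "y \<in> closure (A i)" using y unfolding C_def by blast
      ultimately show False using VW by blast
    qed
  next
    fix n show "x \<in> C n" using UK A(1) closure_subset unfolding C_def by blast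
  qed
  then have "(\<lambda>n. \<phi> (C n)) \<longlonglongrightarrow> \<phi> {x}"
    using \<phi> C dec unfolding sup_measure_def by metis
  then obtain n where n: "\<phi> (C n) < t"
    using order_tendstoD(2)[OF _ t] by (metis (mono_tags, lifting) eventually_sequentially order_refl)
  define G where "G = U \<inter> (\<Inter>i\<le>n. A i)"
  have "G \<subseteq> C n" unfolding G_def C_def using UK closure_subset by blast
  then have "\<phi> G < t" using n sup_measure_mono[OF \<phi>] by (meson le_less_trans)
  moreover have "open G" unfolding G_def using UK A by (intro open_Int open_INT) auto
  moreover have "x \<in> G" unfolding G_def using UK A by blast
  ultimately show ?thesis by blast
qed

lemma sup_measure_open_points_less:
  fixes \<phi> :: "'a::{t2_space, second_countable_topology} set \<Rightarrow> ennreal"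
  assumes "locally_compact_space (euclidean :: 'a topology)" "sup_measure \<phi>"
  shows "open {x. \<phi> {x} < t}"
proof (subst open_subopen, rule ballI)
  fix x assume "x \<in> {x. \<phi> {x} < t}"
  then obtain G where "open G" "x \<in> G" "\<phi> G < t"
    using sup_measure_outer_point[OF assms] by blast
  moreover have "G \<subseteq> {x. \<phi> {x} < t}"
    using \<open>\<phi> G < t\<close> sup_measure_mono[OF assms(2)]
    by (metis (no_types, lifting) empty_subsetI insert_subset le_less_trans mem_Collect_eq subsetI)
  ultimately show "\<exists>T. open T \<and> x \<in> T \<and> T \<subseteq> {x. \<phi> {x} < t}" by blast
qed

text \<open>If \<open>t\<close> exceeds all point values on \<open>K\<close>, every point of
  \<open>K\<close> has an open neighbourhood of value below \<open>t\<close>. These cover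
  \<open>K\<close>, and a sup-measure turns their union into a supremum.\<close>

lemma sup_measure_eq_SUP_points:
  fixes \<phi> :: "'a::{t2_space, second_countable_topology} set \<Rightarrow> ennreal"
  assumes lc: "locally_compact_space (euclidean :: 'a topology)"
    and \<phi>: "sup_measure \<phi>"
  shows "\<phi> K = (SUP x\<in>K. \<phi> {x})"
proof (rule antisym)
  show "(SUP x\<in>K. \<phi> {x}) \<le> \<phi> K"
    using sup_measure_mono[OF \<phi>] by (intro SUP_least) simp
  show "\<phi> K \<le> (SUP x\<in>K. \<phi> {x})"
  proof (rule dense_ge)
    fix t assume t: "(SUP x\<in>K. \<phi> {x}) < t"
    define \<G> where "\<G> = {G. open G \<and> \<phi> G < t}"
    have "\<exists>G\<in>\<G>. x \<in> G" if "x \<in> K" for x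
    proof -
      have "\<phi> {x} < t" using t that by (meson SUP_upper le_less_trans)
      then show ?thesis using sup_measure_outer_point[OF lc \<phi>] unfolding \<G>_def by blast
    qed
    then have "K \<subseteq> \<Union>\<G>" by blast
    then have "\<phi> K \<le> \<phi> (\<Union>\<G>)" by (rule sup_measure_mono[OF \<phi>])
    also have "\<dots> = (SUP G\<in>\<G>. \<phi> G)" by (rule sup_measure_Union_open[OF \<phi>]) (simp add: \<G>_def)
    also have "\<dots> \<le> t" unfolding \<G>_def by (intro SUP_least) auto
    finally show "\<phi> K \<le> t" .
  qed
qed

text \<open>Within a compact \<open>K\<close> the infimum of \<open>f\<close> is at most
  \<open>f x\<close> at each point; conversely the singletons \<open>{x}\<close> are themselves
  admissible compact sets.\<close>

lemma extremal_integral_eq_SUP_points: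
  fixes \<phi> :: "'a::{t2_space, second_countable_topology} set \<Rightarrow> ennreal"
  assumes lc: "locally_compact_space (euclidean :: 'a topology)"
    and \<phi>: "sup_measure \<phi>"
  shows "extremal_integral f \<phi> = (SUP x. ennreal (f x) * \<phi> {x})"
proof (rule antisym)
  show "extremal_integral f \<phi> \<le> (SUP x. ennreal (f x) * \<phi> {x})"
    unfolding extremal_integral_def
  proof (rule SUP_least)
    fix K :: "'a set"
    have "\<phi> K * (INF x\<in>K. ennreal (f x)) = (SUP x\<in>K. \<phi> {x} * (INF x\<in>K. ennreal (f x)))"
      unfolding sup_measure_eq_SUP_points[OF lc \<phi>, of K] by (simp add: SUP_mult_right_ennreal)
    also have "\<dots> \<le> (SUP x. ennreal (f x) * \<phi> {x})"
    proof (rule SUP_least)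
      fix x assume "x \<in> K"
      then have "\<phi> {x} * (INF x\<in>K. ennreal (f x)) \<le> ennreal (f x) * \<phi> {x}"
        by (subst mult.commute) (intro mult_right_mono INF_lower; simp)
      also have "\<dots> \<le> (SUP x. ennreal (f x) * \<phi> {x})" by (intro SUP_upper) simp
      finally show "\<phi> {x} * (INF x\<in>K. ennreal (f x)) \<le> (SUP x. ennreal (f x) * \<phi> {x})" .
    qed
    finally show "\<phi> K * (INF x\<in>K. ennreal (f x)) \<le> (SUP x. ennreal (f x) * \<phi> {x})" .
  qed
  show "(SUP x. ennreal (f x) * \<phi> {x}) \<le> extremal_integral f \<phi>"
    unfolding extremal_integral_def
    by (intro SUP_least SUP_upper2[of "{_}"]) (auto simp: mult.commute)
qed

text \<open>With countable \<open>Q\<close> the extremal integral becomes a countable supremum of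
  weighted values on compact sets, the objects that max-stability controls. A compact
  \<open>K\<close> on which \<open>f\<close> has infimum \<open>c\<close> lies in every level set
  with \<open>q \<le> c\<close>.\<close>

lemma extremal_integral_eq_SUP_levels:
  assumes \<phi>: "sup_measure \<phi>" and f: "\<And>q. 0 < q \<Longrightarrow> compact {x. q \<le> f x}"
    and Q: "Q \<subseteq> {0<..}" "\<And>s t::real. 0 \<le> s \<Longrightarrow> s < t \<Longrightarrow> \<exists>q\<in>Q. s < q \<and> q < t"
  shows "extremal_integral f \<phi> = (SUP q\<in>Q. ennreal q * \<phi> {x. q \<le> f x})"
proof (rule antisym)
  show "extremal_integral f \<phi> \<le> (SUP q\<in>Q. ennreal q * \<phi> {x. q \<le> f x})" (is "_ \<le> ?R")
    unfolding extremal_integral_def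
  proof (rule SUP_least)
    fix K :: "'a set"
    define c where "c = (INF x\<in>K. ennreal (f x))"
    have "c = (SUP q\<in>{q\<in>Q. ennreal q \<le> c}. ennreal q)"
    proof (rule antisym)
      show "c \<le> (SUP q\<in>{q\<in>Q. ennreal q \<le> c}. ennreal q)"
      proof (rule dense_le)
        fix s assume s: "s < c"
        \<comment> \<open>For empty \<open>K\<close> the infimum \<open>c\<close> is infinite;
          \<open>s'\<close> lies below \<open>c\<close> and is therefore finite, so density of
          \<open>Q\<close> can be used between two reals.\<close>
        then obtain s' where s': "s < s'" "s' < c" using dense by blast
        obtain r r' where r: "s = ennreal r" "0 \<le> r" "s' = ennreal r'" "0 \<le> r'"
          using s' by (metis ennreal_cases leD top_greatest)
        then have "r < r'" using s' by (simp add: ennreal_less_iff)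
        then obtain q where q: "q \<in> Q" "r < q" "q < r'" using Q(2) r by blast
        have "ennreal q \<le> c" using q r s' by (meson ennreal_leI le_less less_trans order_trans)
        then have "ennreal q \<le> (SUP q\<in>{q\<in>Q. ennreal q \<le> c}. ennreal q)"
          using q by (intro SUP_upper) auto
        moreover have "s \<le> ennreal q" using r q by (simp add: ennreal_leI)
        ultimately show "s \<le> (SUP q\<in>{q\<in>Q. ennreal q \<le> c}. ennreal q)" by (rule order_trans[rotated])
      qed
    qed (auto intro: SUP_least)
    then have "\<phi> K * c = (SUP q\<in>{q\<in>Q. ennreal q \<le> c}. \<phi> K * ennreal q)"
      by (metis SUP_mult_left_ennreal)
    also have "\<dots> \<le> ?R"
    proof (rule SUP_least)
      fix q assume q: "q \<in> {q\<in>Q. ennreal q \<le> c}"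
      have "q \<le> f x" if "x \<in> K" for x
      proof -
        have "ennreal q \<le> ennreal (f x)" using q that unfolding c_def by (auto simp: le_INF_iff)
        then show ?thesis using q Q(1) by (auto simp: ennreal_le_iff2)
      qed
      then have "\<phi> K \<le> \<phi> {x. q \<le> f x}" by (intro sup_measure_mono[OF \<phi>]) auto
      then have "\<phi> K * ennreal q \<le> ennreal q * \<phi> {x. q \<le> f x}"
        by (simp add: mult.commute mult_left_mono)
      also have "\<dots> \<le> ?R" using q by (intro SUP_upper) auto
      finally show "\<phi> K * ennreal q \<le> ?R" .
    qed
    finally show "\<phi> K * (INF x\<in>K. ennreal (f x)) \<le> ?R" unfolding c_def .
  qed
  show "?R \<le> extremal_integral f \<phi>"
  proof (rule SUP_least)
    fix q assume q: "q \<in> Q"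
    have "ennreal q * \<phi> {x. q \<le> f x} \<le> \<phi> {x. q \<le> f x} * (INF x\<in>{x. q \<le> f x}. ennreal (f x))"
      by (subst mult.commute) (intro mult_left_mono INF_greatest, auto simp: ennreal_leI)
    also have "\<dots> \<le> extremal_integral f \<phi>"
      unfolding extremal_integral_def using f q Q(1) by (intro SUP_upper) auto
    finally show "ennreal q * \<phi> {x. q \<le> f x} \<le> extremal_integral f \<phi>" .
  qed
qed

section \<open>Upper semicontinuous functions\<close>

lemma USC_nonneg: "f \<in> USC \<Longrightarrow> 0 \<le> f x"
  by (simp add: USC_def)

lemma USC_open: "f \<in> USC \<Longrightarrow> open {x. f x < t}"
  by (simp add: USC_def)

lemma USC_bounded:
  assumes "f \<in> USC" obtains c where "0 < c" "\<And>x. f x \<le> c"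
proof -
  obtain c where "\<forall>x. \<bar>f x\<bar> \<le> c" using assms unfolding USC_def bounded_iff by auto
  then have "f x \<le> \<bar>c\<bar> + 1" for x by (smt (verit))
  then show ?thesis using that[of "\<bar>c\<bar> + 1"] by auto
qed

lemma USC_measurable: "f \<in> USC \<Longrightarrow> f \<in> borel_measurable borel"
  by (rule borel_measurableI_less) (simp add: USC_open)

lemma USC_level_compact:
  fixes f :: "'a::t2_space \<Rightarrow> real"
  assumes f: "f \<in> USC" and q: "0 < q"
  shows "compact {x. q \<le> f x}"
proof -
  have "closed {x. q \<le> f x}"
    using USC_open[OF f, of q] by (simp add: closed_def Compl_eq not_le)
  moreover have "{x. q \<le> f x} \<subseteq> closure {x. f x \<noteq> 0}"
    using q closure_subset by fastforce
  ultimately show ?thesis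
    using f unfolding USC_def by (metis (no_types, lifting) closed_Int_compact inf.absorb1 mem_Collect_eq)
qed

lemma USC_I:
  fixes f :: "'a::t2_space \<Rightarrow> real"
  assumes "\<And>x. 0 \<le> f x" "\<And>x. f x \<le> c" "\<And>t. open {x. f x < t}" "compact K" "\<And>x. x \<notin> K \<Longrightarrow> f x = 0"
  shows "f \<in> USC"
proof -
  have "{x. f x \<noteq> 0} \<subseteq> K" using assms(5) by blast
  then have "closure {x. f x \<noteq> 0} \<subseteq> K"
    using assms(4) by (simp add: closure_minimal compact_imp_closed)
  then have "compact (closure {x. f x \<noteq> 0})"
    using assms(4) by (metis closed_Int_compact closed_closure inf.absorb1)
  moreover have "bounded (range f)"
    unfolding bounded_iff using assms(1,2) by (intro exI[of _ c]) auto
  ultimately show ?thesis using assms(1,3) unfolding USC_def by auto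
qed

lemma USC_support:
  fixes f :: "'a::t2_space \<Rightarrow> real"
  assumes "f \<in> USC" obtains K where "compact K" "\<And>x. x \<notin> K \<Longrightarrow> f x = 0"
  using assms closure_subset[of "{x. f x \<noteq> 0}"] unfolding USC_def by blast

lemma USC_add:
  fixes f g :: "'a::t2_space \<Rightarrow> real"
  assumes f: "f \<in> USC" and g: "g \<in> USC"
  shows "(\<lambda>x. f x + g x) \<in> USC"
proof -
  obtain c d where cd: "\<And>x. f x \<le> c" "\<And>x. g x \<le> d" using USC_bounded f g by metis
  obtain K where K: "compact K" "\<And>x. x \<notin> K \<Longrightarrow> f x = 0" using USC_support f by metis
  obtain L where L: "compact L" "\<And>x. x \<notin> L \<Longrightarrow> g x = 0" using USC_support g by metis
  show ?thesis
  proof (rule USC_I)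
    fix t
    have "{x. f x + g x < t} = (\<Union>s. {x. f x < s} \<inter> {x. g x < t - s})"
    proof safe
      fix x assume "f x + g x < t"
      \<comment> \<open>The witness is the midpoint between \<open>f x\<close> and
        \<open>t - g x\<close>.\<close>
      then have "f x < (f x + (t - g x)) / 2" "g x < t - (f x + (t - g x)) / 2"
        by (auto simp: field_simps)
      then show "x \<in> (\<Union>s. {x. f x < s} \<inter> {x. g x < t - s})" by blast
    qed auto
    then show "open {x. f x + g x < t}"
      using USC_open[OF f] USC_open[OF g] by (auto intro!: open_UN open_Int)
  next
    show "compact (K \<union> L)" using K L by blast
  next
    show "f x + g x \<le> c + d" for x using cd by (simp add: add_mono)
  qed (use K L USC_nonneg[OF f] USC_nonneg[OF g] in auto)
qed

lemma USC_scale: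
  fixes f :: "'a::t2_space \<Rightarrow> real"
  assumes f: "f \<in> USC" and c: "0 < c"
  shows "(\<lambda>x. c * f x) \<in> USC"
proof -
  obtain d where d: "\<And>x. f x \<le> d" using USC_bounded f by metis
  obtain K where K: "compact K" "\<And>x. x \<notin> K \<Longrightarrow> f x = 0" using USC_support f by metis
  have "{x. c * f x < t} = {x. f x < t / c}" for t using c by (auto simp: field_simps)
  then show ?thesis
    using USC_open[OF f] USC_nonneg[OF f] c d K by (intro USC_I[of _ "c * d" K]) auto
qed

text \<open>Multiplying by a closed indicator can only lower values, down to 0, on the open
  complement, so strict sublevel sets stay open. It serves to localise extremal integrals to
  \<open>K\<close>.\<close>

lemma USC_times_indicator:
  fixes f :: "'a::t2_space \<Rightarrow> real"
  assumes f: "f \<in> USC" and K: "closed K"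
  shows "(\<lambda>x. f x * indicator K x) \<in> USC"
proof -
  obtain d where d: "\<And>x. f x \<le> d" "0 < d" using USC_bounded f by metis
  obtain L where L: "compact L" "\<And>x. x \<notin> L \<Longrightarrow> f x = 0" using USC_support f by metis
  have "{x. f x * indicator K x < t} = (if 0 < t then {x. f x < t} \<union> - K else {})" for t
    using USC_nonneg[OF f] by (auto simp: indicator_def not_less intro: order_trans)
  then have "open {x. f x * indicator K x < t}" for t
    using USC_open[OF f] K by (auto simp: open_Un)
  then show ?thesis
    using USC_nonneg[OF f] d L by (intro USC_I[of _ d L]) (auto simp: indicator_def less_imp_le)
qed

lemma indicator_compact_in_USC:
  fixes K :: "'a::t2_space set"
  assumes K: "compact K"
  shows "indicator K \<in> USC"
proof -
  have "{x. indicator K x < t} = (if 1 < t then UNIV else if 0 < t then - K else {})" for t :: real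
    by (auto simp: indicator_def)
  then have "open {x. indicator K x < t}" for t :: real
    using compact_imp_closed[OF K] by auto
  then show ?thesis
    using K by (intro USC_I[of _ 1 K]) (auto simp: indicator_def)
qed

text \<open>For nonnegative factors the product is monotone in each, so its strict sublevel set is a
  union of intersections of sublevel sets of \<open>f\<close> and \<open>g\<close>. A small slack
  \<open>e\<close> added to both factors provides the bounds.\<close>

lemma open_usc_times_less:
  fixes f g :: "'a::topological_space \<Rightarrow> real"
  assumes f: "\<And>t. open {x. f x < t}" "\<And>x. 0 \<le> f x" and g: "\<And>t. open {x. g x < t}" "\<And>x. 0 \<le> g x"
  shows "open {x. f x * g x < t}"
proof -
  have "{x. f x * g x < t} = (\<Union>(u, v)\<in>{(u, v). 0 \<le> u \<and> 0 \<le> v \<and> u * v < t}. {x. f x < u} \<inter> {x. g x < v})"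
  proof safe
    fix x assume *: "f x * g x < t"
    have "((\<lambda>e. (f x + e) * (g x + e)) \<longlongrightarrow> (f x + 0) * (g x + 0)) (at_right 0)"
      by (intro tendsto_intros)
    then have "eventually (\<lambda>e. (f x + e) * (g x + e) < t) (at_right 0)"
      using order_tendstoD(2) * by fastforce
    then have "eventually (\<lambda>e. (f x + e) * (g x + e) < t \<and> 0 < e) (at_right (0::real))"
      using eventually_at_right_less by (rule eventually_conj)
    then obtain e where e: "(f x + e) * (g x + e) < t" "0 < e"
      using eventually_happens'[of "at_right (0::real)"] by auto
    show "x \<in> (\<Union>(u, v)\<in>{(u, v). 0 \<le> u \<and> 0 \<le> v \<and> u * v < t}. {x. f x < u} \<inter> {x. g x < v})"
      using e f(2)[of x] g(2)[of x] by (intro UN_I[of "(f x + e, g x + e)"]) auto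
  next
    fix x u v assume "0 \<le> u" "0 \<le> v" "u * v < t" "f x < u" "g x < v"
    then show "f x * g x < t"
      using f(2)[of x] g(2)[of x] mult_mono[of "f x" u "g x" v] by auto
  qed
  then show ?thesis using f(1) g(1) by (auto intro!: open_UN open_Int)
qed

section \<open>Frechet variables\<close>

lemma frechet_scale_nonneg: "frechet_scale P Y a \<Longrightarrow> 0 \<le> a"
  by (simp add: frechet_scale_def)

lemma frechet_scale_measure:
  "frechet_scale P Y a \<Longrightarrow> 0 < t \<Longrightarrow> measure P {\<omega>\<in>space P. Y \<omega> \<le> ennreal t} = exp (- a / t)"
  by (simp add: frechet_scale_def)

lemma frechet_scale_unique: "frechet_scale P Y a \<Longrightarrow> frechet_scale P Y b \<Longrightarrow> a = b"
  using frechet_scale_measure[of P Y a 1] frechet_scale_measure[of P Y b 1] by simp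

text \<open>\<open>measure\<close> is 0 on non-measurable sets, whereas \<open>exp (- a / t)\<close>
  is positive; hence the Frechet law itself forces the sublevel sets to be measurable. Level 0 is a
  countable intersection of positive levels.\<close>

lemma frechet_scale_measurable:
  assumes Y: "frechet_scale P Y a"
  shows "Y \<in> borel_measurable P"
proof -
  have pos: "{\<omega>\<in>space P. Y \<omega> \<le> ennreal t} \<in> sets P" if "0 < t" for t
    using frechet_scale_measure[OF Y that] measure_notin_sets by fastforce
  show ?thesis
  proof (rule borel_measurableI_le)
    fix y :: ennreal
    consider "y = top" | "y = 0" | t where "0 < t" "y = ennreal t"
      by (metis ennreal_cases ennreal_0 less_eq_real_def)
    then show "{\<omega>\<in>space P. Y \<omega> \<le> y} \<in> sets P"
    proof cases
      case 2
      have "Y \<omega> \<le> 0 \<longleftrightarrow> (\<forall>n. Y \<omega> \<le> ennreal (1 / real (Suc n)))" for \<omega>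
      proof
        assume *: "\<forall>n. Y \<omega> \<le> ennreal (1 / real (Suc n))"
        have "(\<lambda>n. ennreal (1 / real (Suc n))) \<longlonglongrightarrow> ennreal 0"
          by (intro tendsto_ennrealI LIMSEQ_Suc[OF lim_1_over_n])
        then show "Y \<omega> \<le> 0"
          using * by (intro Lim_bounded2[where N = 0]) auto
      qed (auto intro: order_trans[of _ 0])
      then have "{\<omega>\<in>space P. Y \<omega> \<le> y} = (\<Inter>n. {\<omega>\<in>space P. Y \<omega> \<le> ennreal (1 / real (Suc n))})"
        using 2 by auto
      then show ?thesis
        using pos by (simp only:) (intro sets.countable_INT'; auto)
    qed (use pos in auto)
  qed
qed

lemma frechet_scale_cmult:
  assumes Y: "frechet_scale P Y a" and c: "0 < c"
  shows "frechet_scale P (\<lambda>\<omega>. ennreal c * Y \<omega>) (c * a)"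
  unfolding frechet_scale_def
proof safe
  show "0 \<le> c * a" using frechet_scale_nonneg[OF Y] c by simp
  fix t :: real assume t: "0 < t"
  have "ennreal c * y \<le> ennreal t \<longleftrightarrow> y \<le> ennreal (t / c)" for y
  proof (cases y)
    case (real r)
    then show ?thesis using c t by (simp add: ennreal_mult[symmetric] pos_le_divide_eq mult.commute)
  qed (use c t in \<open>auto simp: ennreal_mult_top top_unique\<close>)
  then show "measure P {\<omega>\<in>space P. ennreal c * Y \<omega> \<le> ennreal t} = exp (- (c * a) / t)"
    using frechet_scale_measure[OF Y, of "t / c"] c t by (simp add: mult.commute[of c a])
qed

text \<open>The larger variable has the smaller distribution function; comparing at
  \<open>t = 1\<close> already orders the scales.\<close>

lemma (in prob_space) frechet_scale_mono:
  assumes "frechet_scale M Y a" "frechet_scale M Z b" "\<And>\<omega>. \<omega> \<in> space M \<Longrightarrow> Y \<omega> \<le> Z \<omega>"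
  shows "a \<le> b"
proof -
  have [measurable]: "Y \<in> borel_measurable M"
    using assms(1) by (rule frechet_scale_measurable)
  have "measure M {\<omega>\<in>space M. Z \<omega> \<le> ennreal 1} \<le> measure M {\<omega>\<in>space M. Y \<omega> \<le> ennreal 1}"
    using assms(3) by (intro finite_measure_mono) (auto intro: order_trans)
  then show ?thesis
    using frechet_scale_measure[OF assms(1), of 1] frechet_scale_measure[OF assms(2), of 1] by simp
qed

text \<open>The bound \<open>b\<close> makes the increasing scales converge, and continuity of the
  probability along decreasing events passes to the limit in the distribution functions.\<close>

lemma (in prob_space) frechet_scale_SUP:
  assumes Y: "\<And>n::nat. frechet_scale M (Y n) (a n)"
    and inc: "\<And>\<omega>. \<omega> \<in> space M \<Longrightarrow> incseq (\<lambda>n. Y n \<omega>)"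
    and bound: "\<And>n. a n \<le> b"
  shows "\<exists>c. frechet_scale M (\<lambda>\<omega>. SUP n. Y n \<omega>) c"
proof -
  have [measurable]: "Y n \<in> borel_measurable M" for n
    using Y by (rule frechet_scale_measurable)
  have "incseq a"
    unfolding incseq_def using inc by (auto intro!: frechet_scale_mono[OF Y Y] dest: incseqD)
  then obtain c where c: "a \<longlonglongrightarrow> c" "\<And>n. a n \<le> c"
    using incseq_convergent[of a b] bound by metis
  have "frechet_scale M (\<lambda>\<omega>. SUP n. Y n \<omega>) c"
    unfolding frechet_scale_def
  proof safe
    show "0 \<le> c" using c(2)[of 0] frechet_scale_nonneg[OF Y[of 0]] by simp
    fix t :: real assume t: "0 < t"
    let ?A = "\<lambda>n. {\<omega>\<in>space M. Y n \<omega> \<le> ennreal t}"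
    have "decseq ?A"
      unfolding decseq_def using inc by (auto dest: incseqD intro: order_trans)
    then have "(\<lambda>n. measure M (?A n)) \<longlonglongrightarrow> measure M (\<Inter>n. ?A n)"
      by (intro finite_Lim_measure_decseq) auto
    also have "(\<lambda>n. measure M (?A n)) = (\<lambda>n. exp (- a n / t))"
      using frechet_scale_measure[OF Y t] by simp
    finally have 1: "(\<lambda>n. exp (- a n / t)) \<longlonglongrightarrow> measure M (\<Inter>n. ?A n)" .
    have 2: "(\<lambda>n. exp (- a n / t)) \<longlonglongrightarrow> exp (- c / t)"
      using t by (intro tendsto_intros c(1)) auto
    have "(\<Inter>n. ?A n) = {\<omega>\<in>space M. (SUP n. Y n \<omega>) \<le> ennreal t}"
      by (auto simp: SUP_le_iff)
    then show "measure M {\<omega>\<in>space M. (SUP n. Y n \<omega>) \<le> ennreal t} = exp (- c / t)"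
      using LIMSEQ_unique[OF 1 2] by simp
  qed
  then show ?thesis by blast
qed

lemma (in prob_space) frechet_scale_AE_finite:
  assumes Y: "frechet_scale M Y a"
  shows "AE \<omega> in M. Y \<omega> < \<infinity>"
proof -
  have [measurable]: "Y \<in> borel_measurable M"
    using Y by (rule frechet_scale_measurable)
  have "exp (- a / real (Suc n)) \<le> measure M {\<omega>\<in>space M. Y \<omega> < \<infinity>}" for n
    unfolding frechet_scale_measure[OF Y of_nat_0_less_iff[THEN iffD2, OF zero_less_Suc], symmetric]
    by (intro finite_measure_mono) (auto intro: le_less_trans)
  moreover have "(\<lambda>n. exp (- a / real (Suc n))) \<longlonglongrightarrow> exp 0"
    by (intro tendsto_exp LIMSEQ_Suc[OF tendsto_divide_0[OF tendsto_const]] filterlim_real_sequentially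
        filterlim_at_top_imp_at_infinity)
  ultimately have "1 \<le> measure M {\<omega>\<in>space M. Y \<omega> < \<infinity>}"
    by (intro Lim_bounded[where M = 0]) auto
  then have "prob {\<omega>\<in>space M. Y \<omega> < \<infinity>} = 1"
    using prob_le_1 by (simp add: order_antisym)
  then show ?thesis by (subst prob_Collect_eq_1[symmetric]) auto
qed

lemma (in prob_space) frechet_scale_AE_pos:
  assumes Y: "frechet_scale M Y a" and a: "0 < a"
  shows "AE \<omega> in M. 0 < Y \<omega>"
proof -
  have [measurable]: "Y \<in> borel_measurable M"
    using Y by (rule frechet_scale_measurable)
  have "measure M {\<omega>\<in>space M. Y \<omega> = 0} \<le> exp (- a * real (Suc n))" for n
  proof -
    have "measure M {\<omega>\<in>space M. Y \<omega> = 0} \<le> measure M {\<omega>\<in>space M. Y \<omega> \<le> ennreal (1 / real (Suc n))}"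
      by (intro finite_measure_mono) auto
    also have "\<dots> = exp (- a * real (Suc n))"
      using frechet_scale_measure[OF Y, of "1 / real (Suc n)"] by simp
    finally show ?thesis .
  qed
  moreover have "(\<lambda>n. exp (- a * real (Suc n))) \<longlonglongrightarrow> 0"
    using a by real_asymp
  ultimately have "measure M {\<omega>\<in>space M. Y \<omega> = 0} \<le> 0"
    by (intro Lim_bounded2[where N = 0]) auto
  then have "prob {\<omega>\<in>space M. Y \<omega> = 0} = 0"
    using measure_nonneg[of M] by (simp add: order_antisym)
  then have "AE \<omega> in M. \<not> Y \<omega> = 0"
    by (subst (asm) prob_Collect_eq_0) auto
  then show ?thesis by (simp add: zero_less_iff_neq_zero)
qed

text \<open>For \<open>0 < p < 1\<close> this is the \<open>p\<close>-th moment of the Frechet law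
  of scale 1, that is Gamma(1 - p), written as the integral over \<open>s\<close> of the probability
  that the \<open>p\<close>-th power exceeds \<open>s\<close>.\<close>

definition frechet_moment :: "real \<Rightarrow> ennreal" where
  "frechet_moment p = (\<integral>\<^sup>+ s. indicator {0<..} s * ennreal (1 - exp (- 1 / s powr (1 / p))) \<partial>lborel)"

text \<open>The integrand is at most 1 up to 1, and beyond that at most
  \<open>s powr (- 1 / p)\<close> since \<open>1 - exp (- u) \<le> u\<close>; the exponent is
  integrable at infinity because \<open>1 / p > 1\<close>.\<close>

lemma frechet_moment_finite:
  assumes p: "0 < p" "p < 1"
  shows "frechet_moment p < \<infinity>"
proof -
  define r where "r = 1 / p"
  have r: "1 < r" using p by (simp add: r_def)
  have "frechet_moment p \<le> (\<integral>\<^sup>+ s. indicator {0..1} s + ennreal (s powr (- r)) * indicator {1..} s \<partial>lborel)"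
    unfolding frechet_moment_def r_def[symmetric]
  proof (rule nn_integral_mono)
    fix s :: real
    have "1 - exp (- 1 / s powr r) \<le> s powr (- r)"
      using exp_ge_add_one_self[of "- 1 / s powr r"] by (simp add: powr_minus field_simps)
    then show "indicator {0<..} s * ennreal (1 - exp (- 1 / s powr r))
        \<le> indicator {0..1} s + ennreal (s powr (- r)) * indicator {1..} s"
      by (cases s "1::real" rule: linorder_cases)
        (auto simp: indicator_def intro!: ennreal_leI intro: order_trans[of _ 1])
  qed
  also have "\<dots> = emeasure lborel {0..1::real} + (\<integral>\<^sup>+ s. ennreal (s powr (- r)) * indicator {1..} s \<partial>lborel)"
    by (subst nn_integral_add) auto
  also have "(\<integral>\<^sup>+ s. ennreal (s powr (- r)) * indicator {1..} s \<partial>lborel) = ennreal (0 - 1 powr (1 - r) / (1 - r))"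
  proof (rule nn_integral_FTC_atLeast[where F = "\<lambda>x. x powr (1 - r) / (1 - r)"])
    show "((\<lambda>x. x powr (1 - r) / (1 - r)) has_real_derivative x powr - r) (at x)" if "1 \<le> x" for x
      using that r by (auto intro!: derivative_eq_intros)
    show "((\<lambda>x. x powr (1 - r) / (1 - r)) \<longlongrightarrow> 0) at_top"
      using r by real_asymp
  qed auto
  finally show ?thesis by (rule le_less_trans) simp
qed

lemma frechet_moment_pos:
  assumes p: "0 < p"
  shows "0 < frechet_moment p"
proof -
  have "0 < ennreal (1 - exp (- 1)) * emeasure lborel {0<..<1::real}"
    by (simp add: ennreal_zero_less_mult_iff)
  also have "\<dots> = (\<integral>\<^sup>+ s. ennreal (1 - exp (- 1)) * indicator {0<..<1::real} s \<partial>lborel)"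
    by (subst nn_integral_cmult_indicator) auto
  also have "\<dots> \<le> frechet_moment p"
    unfolding frechet_moment_def
  proof (rule nn_integral_mono)
    fix s :: real
    show "ennreal (1 - exp (- 1)) * indicator {0<..<1} s \<le> indicator {0<..} s * ennreal (1 - exp (- 1 / s powr (1 / p)))"
    proof (cases "0 < s \<and> s < 1")
      case True
      then have "s powr (1 / p) \<le> 1" using p by (intro powr_le1) auto
      then have "exp (- 1 / s powr (1 / p)) \<le> exp (- 1)" using True by (simp add: field_simps)
      then show ?thesis using True by (auto simp: indicator_def intro!: ennreal_leI)
    qed (auto simp: indicator_def)
  qed
  finally show ?thesis .
qed

text \<open>The \<open>p\<close>-th power is the length of the interval of levels \<open>s\<close>
  below it; exchanging the two integrals leaves the tail probabilities.\<close>

lemma (in prob_space) frechet_scale_moment: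
  assumes Y: "frechet_scale M Y a" and p: "0 < p" "p < 1"
  shows "(\<integral>\<^sup>+ \<omega>. ennreal (enn2real (Y \<omega>) powr p) \<partial>M) = frechet_moment p * ennreal (a powr p)"
proof -
  have [measurable]: "Y \<in> borel_measurable M"
    using Y by (rule frechet_scale_measurable)
  interpret pair_sigma_finite M "lborel :: real measure" ..
  define F :: "'a \<Rightarrow> real \<Rightarrow> ennreal" where
    "F \<omega> s = (if 0 < s \<and> ennreal (s powr (1 / p)) < Y \<omega> then 1 else 0)" for \<omega> s
  have "(\<integral>\<^sup>+ \<omega>. ennreal (enn2real (Y \<omega>) powr p) \<partial>M) = (\<integral>\<^sup>+ \<omega>. (\<integral>\<^sup>+ s. F \<omega> s \<partial>lborel) \<partial>M)"
  \<comment> \<open>\<open>enn2real\<close> sends an infinite value to 0, so the two integrands are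
    compared only where \<open>Y\<close> is finite.\<close>
  proof (rule nn_integral_cong_AE)
    show "AE \<omega> in M. ennreal (enn2real (Y \<omega>) powr p) = (\<integral>\<^sup>+ s. F \<omega> s \<partial>lborel)"
      using frechet_scale_AE_finite[OF Y]
    proof eventually_elim
      case (elim \<omega>)
      then obtain y where y: "Y \<omega> = ennreal y" "0 \<le> y" by (cases "Y \<omega>") auto
      have "F \<omega> s = indicator {0<..<y powr p} s" for s
      proof (cases "0 < s")
        case True
        have "s powr (1 / p) < y \<longleftrightarrow> s < y powr p"
        proof
          assume "s powr (1 / p) < y"
          then have "(s powr (1 / p)) powr p < y powr p" using p by (intro powr_less_mono2) auto
          then show "s < y powr p" using True p by (simp add: powr_powr)
        next
          assume "s < y powr p"
          then have "s powr (1 / p) < (y powr p) powr (1 / p)"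
            using p True by (intro powr_less_mono2) auto
          then show "s powr (1 / p) < y" using y(2) p by (simp add: powr_powr)
        qed
        then show ?thesis
          using True unfolding F_def y by (simp add: indicator_def ennreal_less_iff)
      qed (auto simp: F_def)
      then have "(\<integral>\<^sup>+ s. F \<omega> s \<partial>lborel) = emeasure lborel {0<..<y powr p}"
        by simp
      then show ?case using y by simp
    qed
  qed
  also have "\<dots> = (\<integral>\<^sup>+ s. (\<integral>\<^sup>+ \<omega>. F \<omega> s \<partial>M) \<partial>lborel)"
    unfolding F_def by (rule Fubini'[symmetric]) measurable
  also have "\<dots> = (\<integral>\<^sup>+ s. indicator {0<..} s * ennreal (1 - exp (- a / s powr (1 / p))) \<partial>lborel)"
  proof (rule nn_integral_cong)
    fix s :: real
    show "(\<integral>\<^sup>+ \<omega>. F \<omega> s \<partial>M) = indicator {0<..} s * ennreal (1 - exp (- a / s powr (1 / p)))"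
    proof (cases "0 < s")
      case True
      let ?A = "{\<omega>\<in>space M. Y \<omega> \<le> ennreal (s powr (1 / p))}"
      have "(\<integral>\<^sup>+ \<omega>. F \<omega> s \<partial>M) = (\<integral>\<^sup>+ \<omega>. indicator (space M - ?A) \<omega> \<partial>M)"
        using True unfolding F_def by (intro nn_integral_cong) (auto simp: indicator_def not_le)
      also have "\<dots> = ennreal (measure M (space M - ?A))"
        by (subst nn_integral_indicator) (auto simp: emeasure_eq_measure)
      also have "measure M (space M - ?A) = 1 - exp (- a / s powr (1 / p))"
        using frechet_scale_measure[OF Y, of "s powr (1 / p)"] True by (subst prob_compl) auto
      finally show ?thesis using True by simp
    qed (simp add: F_def)
  qed
  also have "\<dots> = frechet_moment p * ennreal (a powr p)"
  proof (cases "a = 0")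
    case False
    then have a: "0 < a" using frechet_scale_nonneg[OF Y] by simp
    \<comment> \<open>Stretching \<open>s\<close> by \<open>a powr p\<close> reduces the integral to
      scale 1. For \<open>a = 0\<close> this substitution degenerates, but there both sides
      vanish.\<close>
    have "(\<integral>\<^sup>+ s. indicator {0<..} s * ennreal (1 - exp (- a / s powr (1 / p))) \<partial>lborel) =
      ennreal \<bar>a powr p\<bar> * (\<integral>\<^sup>+ s. indicator {0<..} (0 + a powr p * s) *
         ennreal (1 - exp (- a / (0 + a powr p * s) powr (1 / p))) \<partial>lborel)"
      using a by (intro nn_integral_real_affine) auto
    also have "(\<integral>\<^sup>+ s. indicator {0<..} (0 + a powr p * s) *
         ennreal (1 - exp (- a / (0 + a powr p * s) powr (1 / p))) \<partial>lborel) = frechet_moment p"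
      unfolding frechet_moment_def
      using a p by (intro nn_integral_cong) (auto simp: indicator_def powr_mult powr_powr zero_less_mult_iff)
    finally show ?thesis using a by (simp add: mult.commute)
  qed auto
  finally show ?thesis .
qed

text \<open>After division by \<open>x + y\<close> both terms lie in the unit interval, where
  \<open>t \<le> t powr p\<close>.\<close>

lemma powr_add_le:
  fixes x y p :: real
  assumes "0 \<le> x" "0 \<le> y" "0 < p" "p \<le> 1"
  shows "(x + y) powr p \<le> x powr p + y powr p"
proof (cases "x + y = 0")
  case False
  then have s: "0 < x + y" using assms by simp
  have "t \<le> t powr p" if "0 \<le> t" "t \<le> 1" for t :: real
    using that assms powr_mono'[of p 1 t] by (cases "t = 0") auto
  from this[of "x / (x + y)"] this[of "y / (x + y)"]
  have "x / (x + y) + y / (x + y) \<le> (x / (x + y)) powr p + (y / (x + y)) powr p"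
    using assms s by (intro add_mono) auto
  also have "\<dots> = (x powr p + y powr p) / (x + y) powr p"
    using assms s by (simp add: powr_divide add_divide_distrib)
  finally show ?thesis
    using s by (simp add: add_divide_distrib[symmetric] pos_le_divide_eq)
qed (use assms in auto)

lemma le_add_if_powr_le_powr_add:
  fixes a b c :: real
  assumes "0 \<le> a" "0 \<le> b" "0 \<le> c"
    and le: "\<And>p. 0 < p \<Longrightarrow> p < 1 \<Longrightarrow> c powr p \<le> a powr p + b powr p"
  shows "c \<le> a + b"
proof -
  have lim: "((\<lambda>p. x powr p) \<longlongrightarrow> x) (at_left 1)" if "0 \<le> x" for x :: real
  proof (cases "x = 0")
    case False
    have "((\<lambda>p. x powr p) \<longlongrightarrow> x powr 1) (at_left 1)"
      using False by (intro tendsto_intros) auto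
    then show ?thesis using that by simp
  qed auto
  have "eventually (\<lambda>p. p \<in> {0<..<1}) (at_left (1::real))"
    by (rule eventually_at_left_real) simp
  then have ev: "eventually (\<lambda>p. c powr p \<le> a powr p + b powr p) (at_left 1)"
    by (rule eventually_mono) (simp add: le)
  show ?thesis
    by (rule tendsto_le[OF _ tendsto_add[OF lim lim] lim ev]) (use assms in auto)
qed

section \<open>Measurable selection from random compact sets\<close>

text \<open>Run through a countable point-separating family of closed sets \<open>Q n\<close> and
  cut the current set by \<open>Q n\<close> whenever they meet. The compact sets shrink to a single
  point, and all choices depend on measurable hitting events.\<close>

lemma measurable_selection_compact:
  fixes F :: "'w \<Rightarrow> 'a::{t2_space, second_countable_topology} set"
  assumes F: "\<And>\<omega>. \<omega> \<in> space M \<Longrightarrow> compact (F \<omega>)" "\<And>\<omega>. \<omega> \<in> space M \<Longrightarrow> F \<omega> \<noteq> {}"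
    and meas: "\<And>K. closed K \<Longrightarrow> {\<omega>\<in>space M. F \<omega> \<inter> K \<noteq> {}} \<in> sets M"
  shows "\<exists>s\<in>measurable M borel. \<forall>\<omega>\<in>space M. s \<omega> \<in> F \<omega>"
proof -
  obtain B :: "'a set set" where B: "countable B" "topological_basis B"
    using ex_countable_basis by blast
  have "B \<noteq> {}"
    using B(2) topological_basisE[of B UNIV] by (metis UNIV_I empty_iff open_UNIV)
  define Q where "Q n = closure (from_nat_into B n)" for n
  have Q: "closed (Q n)" for n by (simp add: Q_def)
  have sep: "\<exists>n. x \<in> Q n \<and> y \<notin> Q n" if "x \<noteq> y" for x y
  proof -
    obtain V W where VW: "open V" "open W" "x \<in> V" "y \<in> W" "V \<inter> W = {}"
      using hausdorff[OF \<open>x \<noteq> y\<close>] by metis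
    obtain A where A: "A \<in> B" "x \<in> A" "A \<subseteq> V"
      using topological_basisE[OF B(2) VW(1,3)] by metis
    obtain n where n: "from_nat_into B n = A"
      using from_nat_into_surj[OF B(1) A(1)] by metis
    have "closure A \<inter> W = {}" using VW A open_Int_closure_eq_empty[of W A] by blast
    then have "x \<in> Q n \<and> y \<notin> Q n" using n A VW closure_subset unfolding Q_def by blast
    then show ?thesis ..
  qed
  define C where "C \<omega> = rec_nat (F \<omega>) (\<lambda>n A. if A \<inter> Q n = {} then A else A \<inter> Q n)" for \<omega>
  have C_0: "C \<omega> 0 = F \<omega>"
    and C_Suc: "C \<omega> (Suc n) = (if C \<omega> n \<inter> Q n = {} then C \<omega> n else C \<omega> n \<inter> Q n)" for \<omega> n
    unfolding C_def by simp_all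
  have C: "compact (C \<omega> n)" "C \<omega> n \<noteq> {}" if "\<omega> \<in> space M" for \<omega> n
    by (induction n) (use that F Q in \<open>auto simp: C_0 C_Suc intro: compact_Int_closed\<close>)
  have dec: "decseq (C \<omega>)" for \<omega>
    by (rule decseq_SucI) (auto simp: C_Suc)
  have C_meas: "{\<omega>\<in>space M. C \<omega> n \<inter> K \<noteq> {}} \<in> sets M" if "closed K" for n K
    using that
  proof (induction n arbitrary: K)
    case 0
    then show ?case using meas by (simp add: C_0)
  next
    case (Suc n)
    \<comment> \<open>Either the cut takes place and \<open>K\<close> is hit inside
      \<open>Q n\<close>, or \<open>Q n\<close> is missed and the set is unchanged.\<close>
    have "{\<omega>\<in>space M. C \<omega> (Suc n) \<inter> K \<noteq> {}} =
      {\<omega>\<in>space M. C \<omega> n \<inter> (Q n \<inter> K) \<noteq> {}} \<union>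
      ({\<omega>\<in>space M. C \<omega> n \<inter> K \<noteq> {}} - {\<omega>\<in>space M. C \<omega> n \<inter> Q n \<noteq> {}})"
      by (auto simp: C_Suc)
    then show ?case
      using Suc.IH[of "Q n \<inter> K"] Suc.IH[of "Q n"] Suc.IH[of K] Suc.prems Q
      by (simp only:) (intro sets.Un sets.Diff; simp add: closed_Int)
  qed
  have singleton: "x = y" if xy: "x \<in> (\<Inter>n. C \<omega> n)" "y \<in> (\<Inter>n. C \<omega> n)" for x y \<omega>
  proof (rule ccontr)
    assume "x \<noteq> y"
    then obtain n where n: "x \<in> Q n" "y \<notin> Q n" using sep by blast
    have "x \<in> C \<omega> n" "y \<in> C \<omega> (Suc n)" using xy by blast+
    then show False using n by (auto simp: C_Suc split: if_splits)
  qed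
  define s where "s \<omega> = (SOME x. x \<in> (\<Inter>n. C \<omega> n))" for \<omega>
  have s: "s \<omega> \<in> (\<Inter>n. C \<omega> n)" if "\<omega> \<in> space M" for \<omega>
  proof -
    have "(\<Inter>n. C \<omega> n) \<noteq> {}" using C[OF that] dec by (rule nested_compact_nonempty)
    then show ?thesis unfolding s_def by (simp only: some_in_eq not_False_eq_True)
  qed
  \<comment> \<open>By compactness the limit point lies in \<open>K\<close> as soon as every stage
    hits \<open>K\<close>; preimages of closed sets are thus countable intersections of hitting
    events.\<close>
  have s_in: "s \<omega> \<in> K \<longleftrightarrow> (\<forall>n. C \<omega> n \<inter> K \<noteq> {})" if \<omega>: "\<omega> \<in> space M" and K: "closed K" for \<omega> K
  proof
    assume "\<forall>n. C \<omega> n \<inter> K \<noteq> {}"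
    moreover have "decseq (\<lambda>n. C \<omega> n \<inter> K)"
      using dec[of \<omega>] by (simp add: decseq_def le_infI1)
    moreover have "compact (C \<omega> n \<inter> K)" for n
      using C(1)[OF \<omega>] K by (rule compact_Int_closed)
    ultimately have "(\<Inter>n. C \<omega> n \<inter> K) \<noteq> {}"
      by (intro nested_compact_nonempty) simp_all
    then show "s \<omega> \<in> K" using singleton[OF _ s[OF \<omega>]] by blast
  qed (use s[OF \<omega>] in blast)
  have "s \<in> measurable M borel"
  proof (rule borel_measurableI)
    fix S :: "'a set" assume "open S"
    then have "closed (- S)" by (simp only: closed_Compl)
    have "s -` S \<inter> space M = space M - (\<Inter>n. {\<omega>\<in>space M. C \<omega> n \<inter> - S \<noteq> {}})"
      using s_in[OF _ \<open>closed (- S)\<close>] by auto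
    then show "s -` S \<inter> space M \<in> sets M"
      using C_meas[OF \<open>closed (- S)\<close>] by (simp only:) (intro sets.Diff sets.top sets.countable_INT'; auto)
  qed
  moreover have "s \<omega> \<in> F \<omega>" if "\<omega> \<in> space M" for \<omega>
    using s[OF that] C_0 by blast
  ultimately show ?thesis by blast
qed

section \<open>The tail dependence functional\<close>

locale max_stable_sup_measure = prob_space P
  for P :: "'w measure" +
  fixes X :: "'w \<Rightarrow> 'a::{t2_space, second_countable_topology} set \<Rightarrow> ennreal"
  assumes locally_compact: "locally_compact_space (euclidean :: 'a topology)"
    and sup_measure_X: "\<And>\<omega>. \<omega> \<in> space P \<Longrightarrow> sup_measure (X \<omega>)"
    and max_stable: "max_stable P X"
begin

abbreviation ell :: "('a \<Rightarrow> real) \<Rightarrow> real" where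
  "ell \<equiv> tail_dependence P X"

lemma compact_frechet_scale:
  assumes "compact K"
  obtains a where "frechet_scale P (\<lambda>\<omega>. X \<omega> K) a"
  using max_stable[unfolded max_stable_def unit_frechet_def, rule_format, of 1 "\<lambda>_. K" "\<lambda>_. 1"] assms
  by (auto simp: lessThan_Suc)

text \<open>Max-stability covers finite maxima over level sets; along an enumeration of the positive
  rational levels these increase to the extremal integral. Uniqueness of the scale then identifies
  the limit with \<open>ell f\<close>.\<close>

lemma frechet_scale_extremal_integral:
  assumes f: "f \<in> USC"
  shows "frechet_scale P (\<lambda>\<omega>. extremal_integral f (X \<omega>)) (ell f)"
proof -
  define Q :: "real set" where "Q = {q\<in>\<rat>. 0 < q}"
  have "countable Q" using countable_rat unfolding Q_def by (rule countable_subset[rotated]) auto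
  moreover have "1 \<in> Q" by (simp add: Q_def)
  ultimately have Q: "range (from_nat_into Q) = Q" by (intro range_from_nat_into) auto
  define q where "q = from_nat_into Q"
  have q: "0 < q n" for n using Q by (auto simp: Q_def q_def)
  define L where "L n = {x. q n \<le> f x}" for n
  have L: "compact (L n)" for n unfolding L_def using f q by (rule USC_level_compact)
  define Y where "Y n \<omega> = (SUP i\<in>{..<n}. ennreal (q i) * X \<omega> (L i))" for n \<omega>
  have "\<exists>a. frechet_scale P (Y n) a" for n
    using max_stable[unfolded max_stable_def unit_frechet_def, rule_format, of n L q] L q
    unfolding Y_def by (simp add: less_imp_le)
  then obtain a where a: "\<And>n. frechet_scale P (Y n) (a n)" by metis
  obtain c where c: "0 < c" "\<And>x. f x \<le> c" using USC_bounded[OF f] by metis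
  obtain K where K: "compact K" "\<And>x. x \<notin> K \<Longrightarrow> f x = 0" using USC_support[OF f] by metis
  obtain b where "frechet_scale P (\<lambda>\<omega>. X \<omega> K) b" using compact_frechet_scale[OF K(1)] .
  then have b: "frechet_scale P (\<lambda>\<omega>. ennreal c * X \<omega> K) (c * b)" using c(1) by (rule frechet_scale_cmult)
  \<comment> \<open>All finite maxima are dominated by \<open>c * X K\<close>, where
    \<open>c\<close> bounds \<open>f\<close> and \<open>K\<close> carries it. An empty level set is
    treated apart because its \<open>q i\<close> may exceed \<open>c\<close>.\<close>
  have "a n \<le> c * b" for n
  proof (rule frechet_scale_mono[OF a b])
    fix \<omega> assume \<omega>: "\<omega> \<in> space P"
    show "Y n \<omega> \<le> ennreal c * X \<omega> K"
      unfolding Y_def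
    proof (rule SUP_least)
      fix i
      show "ennreal (q i) * X \<omega> (L i) \<le> ennreal c * X \<omega> K"
      proof (cases "L i = {}")
        case True
        then show ?thesis using sup_measure_X[OF \<omega>] by (simp add: sup_measure_def)
      next
        case False
        then obtain x where "q i \<le> f x" by (auto simp: L_def)
        then have "q i \<le> c" using c(2)[of x] by simp
        moreover have "L i \<subseteq> K"
          using K(2) q[of i] unfolding L_def by force
        ultimately show ?thesis
          using sup_measure_mono[OF sup_measure_X[OF \<omega>]] by (intro mult_mono ennreal_leI) auto
      qed
    qed
  qed
  moreover have "incseq (\<lambda>n. Y n \<omega>)" for \<omega>
    unfolding Y_def incseq_def by (auto intro!: SUP_subset_mono)
  ultimately obtain d where d: "frechet_scale P (\<lambda>\<omega>. SUP n. Y n \<omega>) d"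
    using frechet_scale_SUP[of Y a "c * b"] a by blast
  have "(SUP n. Y n \<omega>) = extremal_integral f (X \<omega>)" if \<omega>: "\<omega> \<in> space P" for \<omega>
  proof -
    have "extremal_integral f (X \<omega>) = (SUP r\<in>Q. ennreal r * X \<omega> {x. r \<le> f x})"
    proof (rule extremal_integral_eq_SUP_levels[OF sup_measure_X[OF \<omega>] USC_level_compact[OF f]])
      show "\<exists>q\<in>Q. s < q \<and> q < t" if "0 \<le> s" "s < t" for s t
        using Rats_dense_in_real[OF that(2)] that(1) unfolding Q_def by force
    qed (auto simp: Q_def)
    also have "\<dots> = (SUP i. ennreal (q i) * X \<omega> (L i))"
      unfolding L_def q_def by (subst Q[symmetric]) (simp only: image_image)
    also have "\<dots> = (SUP n. Y n \<omega>)"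
    proof (rule antisym)
      show "(SUP i. ennreal (q i) * X \<omega> (L i)) \<le> (SUP n. Y n \<omega>)"
      proof (rule SUP_least)
        fix i
        have "ennreal (q i) * X \<omega> (L i) \<le> Y (Suc i) \<omega>" unfolding Y_def by (intro SUP_upper) simp
        also have "\<dots> \<le> (SUP n. Y n \<omega>)" by (intro SUP_upper) simp
        finally show "ennreal (q i) * X \<omega> (L i) \<le> (SUP n. Y n \<omega>)" .
      qed
    qed (auto simp: Y_def intro!: SUP_least SUP_upper)
    finally show ?thesis by simp
  qed
  then have "frechet_scale P (\<lambda>\<omega>. extremal_integral f (X \<omega>)) d"
    using d unfolding frechet_scale_def by (simp cong: conj_cong)
  then show ?thesis
    unfolding tail_dependence_def by (metis theI frechet_scale_unique)
qed

lemma tail_dependence_nonneg: "f \<in> USC \<Longrightarrow> 0 \<le> ell f"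
  using frechet_scale_extremal_integral frechet_scale_nonneg by blast

lemma extremal_integral_point_le:
  assumes "\<omega> \<in> space P"
  shows "ennreal (f x) * X \<omega> {x} \<le> extremal_integral f (X \<omega>)"
  unfolding extremal_integral_eq_SUP_points[OF locally_compact sup_measure_X[OF assms]]
  by (rule SUP_upper) simp

lemma tail_dependence_scale:
  assumes f: "f \<in> USC" and c: "0 < c"
  shows "ell (\<lambda>x. c * f x) = c * ell f"
proof -
  have "ennreal c * extremal_integral f (X \<omega>) = extremal_integral (\<lambda>x. c * f x) (X \<omega>)"
    if \<omega>: "\<omega> \<in> space P" for \<omega>
    unfolding extremal_integral_eq_SUP_points[OF locally_compact sup_measure_X[OF \<omega>]]
    using c USC_nonneg[OF f] by (simp add: SUP_mult_left_ennreal ennreal_mult mult.assoc)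
  then have "frechet_scale P (\<lambda>\<omega>. extremal_integral (\<lambda>x. c * f x) (X \<omega>)) (c * ell f)"
    using frechet_scale_cmult[OF frechet_scale_extremal_integral[OF f] c]
    unfolding frechet_scale_def by (simp cong: conj_cong)
  then show ?thesis
    using frechet_scale_extremal_integral[OF USC_scale[OF f c]] frechet_scale_unique by blast
qed

text \<open>Outcome by outcome the extremal integral is subadditive, by its formula over points. A
  Frechet variable of positive scale has infinite mean, so the comparison runs through moments of
  order \<open>p < 1\<close>.\<close>

lemma tail_dependence_subadditive:
  assumes f: "f \<in> USC" and g: "g \<in> USC"
  shows "ell (\<lambda>x. f x + g x) \<le> ell f + ell g"
proof (rule le_add_if_powr_le_powr_add)
  have fg: "(\<lambda>x. f x + g x) \<in> USC" using f g by (rule USC_add)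
  show "0 \<le> ell f" "0 \<le> ell g" "0 \<le> ell (\<lambda>x. f x + g x)"
    using f g fg by (auto intro: tail_dependence_nonneg)
  fix p :: real assume p: "0 < p" "p < 1"
  note fr = frechet_scale_extremal_integral
  have [measurable]: "(\<lambda>\<omega>. extremal_integral f (X \<omega>)) \<in> borel_measurable P"
    "(\<lambda>\<omega>. extremal_integral g (X \<omega>)) \<in> borel_measurable P"
    using fr[OF f] fr[OF g] by (auto intro: frechet_scale_measurable)
  have "frechet_moment p * ennreal (ell (\<lambda>x. f x + g x) powr p) =
      (\<integral>\<^sup>+\<omega>. ennreal (enn2real (extremal_integral (\<lambda>x. f x + g x) (X \<omega>)) powr p) \<partial>P)"
    by (rule frechet_scale_moment[OF fr[OF fg] p, symmetric])
  also have "\<dots> \<le> (\<integral>\<^sup>+\<omega>. ennreal (enn2real (extremal_integral f (X \<omega>)) powr p) +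
       ennreal (enn2real (extremal_integral g (X \<omega>)) powr p) \<partial>P)"
  proof (rule nn_integral_mono_AE)
    show "AE \<omega> in P. ennreal (enn2real (extremal_integral (\<lambda>x. f x + g x) (X \<omega>)) powr p)
      \<le> ennreal (enn2real (extremal_integral f (X \<omega>)) powr p) +
       ennreal (enn2real (extremal_integral g (X \<omega>)) powr p)"
      using frechet_scale_AE_finite[OF fr[OF f]] frechet_scale_AE_finite[OF fr[OF g]] AE_space
    proof eventually_elim
      case (elim \<omega>)
      let ?If = "extremal_integral f (X \<omega>)" and ?Ig = "extremal_integral g (X \<omega>)"
      have "extremal_integral (\<lambda>x. f x + g x) (X \<omega>) \<le> ?If + ?Ig"
        unfolding extremal_integral_eq_SUP_points[OF locally_compact sup_measure_X[OF elim(3)],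
            of "\<lambda>x. f x + g x"]
      proof (rule SUP_least)
        fix x
        show "ennreal (f x + g x) * X \<omega> {x} \<le> ?If + ?Ig"
          using USC_nonneg[OF f, of x] USC_nonneg[OF g, of x] extremal_integral_point_le[OF elim(3), of f x]
            extremal_integral_point_le[OF elim(3), of g x]
          by (simp add: distrib_right add_mono)
      qed
      then have "enn2real (extremal_integral (\<lambda>x. f x + g x) (X \<omega>)) \<le> enn2real ?If + enn2real ?Ig"
        using elim enn2real_mono[of "extremal_integral (\<lambda>x. f x + g x) (X \<omega>)" "?If + ?Ig"]
        by (simp add: enn2real_plus)
      then have "enn2real (extremal_integral (\<lambda>x. f x + g x) (X \<omega>)) powr p
          \<le> (enn2real ?If + enn2real ?Ig) powr p"
        using p by (intro powr_mono2) auto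
      also have "\<dots> \<le> enn2real ?If powr p + enn2real ?Ig powr p"
        using p by (intro powr_add_le) auto
      finally show ?case
        by (simp add: ennreal_leI flip: ennreal_plus)
    qed
  qed
  also have "\<dots> = frechet_moment p * ennreal (ell f powr p) + frechet_moment p * ennreal (ell g powr p)"
    by (subst nn_integral_add) (simp_all add: frechet_scale_moment[OF fr[OF f] p] frechet_scale_moment[OF fr[OF g] p])
  also have "\<dots> = frechet_moment p * ennreal (ell f powr p + ell g powr p)"
    by (simp add: distrib_left)
  \<comment> \<open>The common factor \<open>frechet_moment p\<close> cancels because it is positive
    and finite.\<close>
  finally have "ennreal (ell (\<lambda>x. f x + g x) powr p) \<le> ennreal (ell f powr p + ell g powr p)"
    using frechet_moment_pos[OF p(1)] frechet_moment_finite[OF p]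
    by (subst (asm) ennreal_mult_le_mult_iff) auto
  then show "ell (\<lambda>x. f x + g x) powr p \<le> ell f powr p + ell g powr p"
    by (simp flip: ennreal_plus)
qed

end

section \<open>Supporting measures\<close>

text \<open>A product of two nonnegative upper semicontinuous functions has closed upper level sets,
  and those at positive levels lie in a compact set carrying \<open>f\<close>.\<close>

lemma compact_product_level:
  fixes \<phi> :: "'a::{t2_space, second_countable_topology} set \<Rightarrow> ennreal"
  assumes lc: "locally_compact_space (euclidean :: 'a topology)"
    and \<phi>: "sup_measure \<phi>" and f: "f \<in> USC" and m: "0 < m"
  shows "compact {x. m \<le> f x * enn2real (\<phi> {x})}"
proof -
  \<comment> \<open>Singletons are compact and so have finite value, which makes
    \<open>enn2real\<close> harmless here.\<close>
  have "{x. enn2real (\<phi> {x}) < t} = (if 0 < t then {x. \<phi> {x} < ennreal t} else {})" for t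
  proof -
    have "enn2real (\<phi> {x}) < t \<longleftrightarrow> \<phi> {x} < ennreal t" if "0 < t" for x
      using sup_measure_compact_finite[OF \<phi>, of "{x}"] that
      by (cases "\<phi> {x}") (auto simp: ennreal_less_iff)
    then show ?thesis by (auto simp: not_less intro: order_trans[OF _ enn2real_nonneg])
  qed
  then have "open {x. enn2real (\<phi> {x}) < t}" for t
    using sup_measure_open_points_less[OF lc \<phi>] by simp
  then have "open {x. f x * enn2real (\<phi> {x}) < m}"
    using USC_open[OF f] USC_nonneg[OF f] by (intro open_usc_times_less) auto
  moreover have "{x. m \<le> f x * enn2real (\<phi> {x})} = - {x. f x * enn2real (\<phi> {x}) < m}"
    by auto
  ultimately have closed: "closed {x. m \<le> f x * enn2real (\<phi> {x})}"
    by (simp only: closed_Compl)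
  obtain K where K: "compact K" "\<And>x. x \<notin> K \<Longrightarrow> f x = 0" using USC_support[OF f] by metis
  have "{x. m \<le> f x * enn2real (\<phi> {x})} \<subseteq> K" using K(2) m by force
  then show ?thesis using compact_Int_closed[OF K(1) closed] by (simp add: Int_absorb1)
qed

text \<open>The supremum over \<open>K\<close> is attained: levels \<open>r n\<close> increasing to
  \<open>m\<close> give nested nonempty compact sets, and a common point reaches
  \<open>m\<close>.\<close>

lemma product_level_meets_iff:
  fixes \<phi> :: "'a::{t2_space, second_countable_topology} set \<Rightarrow> ennreal"
  assumes lc: "locally_compact_space (euclidean :: 'a topology)"
    and \<phi>: "sup_measure \<phi>" and f: "f \<in> USC" and m: "0 < m" and K: "closed K"
  shows "{x. m \<le> f x * enn2real (\<phi> {x})} \<inter> K \<noteq> {} \<longleftrightarrow>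
    ennreal m \<le> extremal_integral (\<lambda>x. f x * indicator K x) \<phi>"
proof -
  have fin: "ennreal (f x) * \<phi> {x} = ennreal (f x * enn2real (\<phi> {x}))" for x
    using sup_measure_compact_finite[OF \<phi>, of "{x}"] USC_nonneg[OF f, of x]
    by (simp add: ennreal_mult)
  have eq: "extremal_integral (\<lambda>x. f x * indicator K x) \<phi> =
      (SUP x. ennreal (f x * indicator K x) * \<phi> {x})"
    by (rule extremal_integral_eq_SUP_points[OF lc \<phi>])
  show ?thesis
  proof
    assume "{x. m \<le> f x * enn2real (\<phi> {x})} \<inter> K \<noteq> {}"
    then obtain x where x: "m \<le> f x * enn2real (\<phi> {x})" "x \<in> K" by blast
    then have "ennreal m \<le> ennreal (f x * indicator K x) * \<phi> {x}"
      by (simp add: fin ennreal_leI)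
    also have "\<dots> \<le> (SUP x. ennreal (f x * indicator K x) * \<phi> {x})" by (rule SUP_upper) simp
    finally show "ennreal m \<le> extremal_integral (\<lambda>x. f x * indicator K x) \<phi>" unfolding eq .
  next
    assume le: "ennreal m \<le> extremal_integral (\<lambda>x. f x * indicator K x) \<phi>"
    \<comment> \<open>The double \<open>Suc\<close> makes \<open>r 0 = m / 2\<close> positive, as
      compactness of the level sets requires.\<close>
    define r where "r n = m * (1 - 1 / real (Suc (Suc n)))" for n
    have r: "0 < r n" "r n < m" for n
      using m by (simp_all add: r_def)
    have "(\<lambda>n. m * (1 - 1 / real (Suc (Suc n)))) \<longlonglongrightarrow> m * (1 - 0)"
      by (intro tendsto_intros LIMSEQ_Suc[OF LIMSEQ_Suc[OF lim_1_over_n]])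
    then have r_lim: "r \<longlonglongrightarrow> m" unfolding r_def by simp
    have "incseq r"
      unfolding r_def by (rule incseq_SucI) (use m in \<open>auto intro!: mult_left_mono divide_left_mono\<close>)
    define C where "C n = {x. r n \<le> f x * enn2real (\<phi> {x})} \<inter> K" for n
    have "(\<Inter>n. C n) \<noteq> {}"
    proof (rule nested_compact_nonempty)
      show "compact (C n)" for n
        unfolding C_def using compact_product_level[OF lc \<phi> f r(1)] K by (rule compact_Int_closed)
      show "decseq C"
        unfolding decseq_def C_def using \<open>incseq r\<close> by (auto dest: incseqD intro: order_trans)
      show "C n \<noteq> {}" for n
      proof -
        have "ennreal (r n) < ennreal m" using r m by (simp add: ennreal_less_iff less_imp_le)
        then have "ennreal (r n) < (SUP x. ennreal (f x * indicator K x) * \<phi> {x})"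
          using le unfolding eq by (rule less_le_trans)
        then obtain x where x: "ennreal (r n) < ennreal (f x * indicator K x) * \<phi> {x}"
          by (auto simp: less_SUP_iff)
        then have "x \<in> K" by (cases "x \<in> K") auto
        then have "r n \<le> f x * enn2real (\<phi> {x})"
          using x r(1)[of n] by (simp add: fin ennreal_less_iff less_imp_le)
        then show ?thesis using \<open>x \<in> K\<close> unfolding C_def by blast
      qed
    qed
    then obtain x where x: "\<And>n. x \<in> C n" by blast
    then have "m \<le> f x * enn2real (\<phi> {x})"
      using r_lim by (intro LIMSEQ_le_const2[of r m]) (auto simp: C_def)
    then show "{x. m \<le> f x * enn2real (\<phi> {x})} \<inter> K \<noteq> {}"
      using x unfolding C_def by blast
  qed
qed

context max_stable_sup_measure
begin

lemma measurable_extremal_integral: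
  "f \<in> USC \<Longrightarrow> (\<lambda>\<omega>. extremal_integral f (X \<omega>)) \<in> borel_measurable P"
  by (rule frechet_scale_measurable[OF frechet_scale_extremal_integral])

text \<open>Restricting \<open>f\<close> to a closed set \<open>K\<close> turns the hitting event of the set of maximisers into a
  comparison of two extremal integrals.\<close>

lemma measurable_maximiser:
  assumes f: "f \<in> USC" and pos: "0 < ell f"
  obtains s where "s \<in> measurable P borel"
    "AE \<omega> in P. 0 < extremal_integral f (X \<omega>) \<and> extremal_integral f (X \<omega>) < \<infinity> \<and>
       f (s \<omega>) * enn2real (X \<omega> {s \<omega>}) = enn2real (extremal_integral f (X \<omega>))"
proof -
  define M where "M \<omega> = extremal_integral f (X \<omega>)" for \<omega>
  have M_meas [measurable]: "M \<in> borel_measurable P"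
    unfolding M_def using f by (rule measurable_extremal_integral)
  \<comment> \<open>Off the event of a positive finite maximum, \<open>F\<close> is a fixed
    arbitrary singleton, so it is compact and nonempty for every outcome.\<close>
  define F where "F \<omega> = (if 0 < M \<omega> \<and> M \<omega> < \<infinity>
    then {x. enn2real (M \<omega>) \<le> f x * enn2real (X \<omega> {x})} else {undefined})" for \<omega>
  have hit: "F \<omega> \<inter> K \<noteq> {} \<longleftrightarrow> M \<omega> \<le> extremal_integral (\<lambda>x. f x * indicator K x) (X \<omega>)"
    if "\<omega> \<in> space P" "closed K" "0 < M \<omega> \<and> M \<omega> < \<infinity>" for \<omega> K
    using product_level_meets_iff[OF locally_compact sup_measure_X[OF that(1)] f _ that(2),
        of "enn2real (M \<omega>)"] that(3)
    by (simp add: F_def enn2real_positive_iff)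
  have "\<exists>s\<in>measurable P borel. \<forall>\<omega>\<in>space P. s \<omega> \<in> F \<omega>"
  proof (rule measurable_selection_compact)
    fix \<omega> assume \<omega>: "\<omega> \<in> space P"
    show "compact (F \<omega>)"
      using compact_product_level[OF locally_compact sup_measure_X[OF \<omega>] f, of "enn2real (M \<omega>)"]
      by (simp add: F_def enn2real_positive_iff)
    show "F \<omega> \<noteq> {}"
    proof (cases "0 < M \<omega> \<and> M \<omega> < \<infinity>")
      case True
      \<comment> \<open>With \<open>K = UNIV\<close> the hitting criterion compares \<open>M\<close>
        with itself.\<close>
      then show ?thesis using hit[OF \<omega> closed_UNIV True] by (simp add: M_def)
    qed (auto simp: F_def)
  next
    fix K :: "'a set" assume K: "closed K"
    have [measurable]: "(\<lambda>\<omega>. extremal_integral (\<lambda>x. f x * indicator K x) (X \<omega>)) \<in> borel_measurable P"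
      using USC_times_indicator[OF f K] by (rule measurable_extremal_integral)
    have "{\<omega>\<in>space P. F \<omega> \<inter> K \<noteq> {}} =
      {\<omega>\<in>space P. if 0 < M \<omega> \<and> M \<omega> < \<infinity>
        then M \<omega> \<le> extremal_integral (\<lambda>x. f x * indicator K x) (X \<omega>) else undefined \<in> K}"
    proof (rule Collect_cong, rule conj_cong[OF refl])
      fix \<omega> assume \<omega>: "\<omega> \<in> space P"
      show "F \<omega> \<inter> K \<noteq> {} \<longleftrightarrow> (if 0 < M \<omega> \<and> M \<omega> < \<infinity>
        then M \<omega> \<le> extremal_integral (\<lambda>x. f x * indicator K x) (X \<omega>) else undefined \<in> K)"
      proof (cases "0 < M \<omega> \<and> M \<omega> < \<infinity>")
        case True
        then show ?thesis using hit[OF \<omega> K True] by simp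
      next
        case False
        then show ?thesis by (auto simp: F_def)
      qed
    qed
    also have "\<dots> \<in> sets P" by measurable
    finally show "{\<omega>\<in>space P. F \<omega> \<inter> K \<noteq> {}} \<in> sets P" .
  qed
  then obtain s where s: "s \<in> measurable P borel" "\<And>\<omega>. \<omega> \<in> space P \<Longrightarrow> s \<omega> \<in> F \<omega>" by blast
  have "AE \<omega> in P. 0 < extremal_integral f (X \<omega>) \<and> extremal_integral f (X \<omega>) < \<infinity> \<and>
       f (s \<omega>) * enn2real (X \<omega> {s \<omega>}) = enn2real (extremal_integral f (X \<omega>))"
    using frechet_scale_AE_pos[OF frechet_scale_extremal_integral[OF f] pos]
      frechet_scale_AE_finite[OF frechet_scale_extremal_integral[OF f]] AE_space
  proof eventually_elim
    case (elim \<omega>)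
    then have "enn2real (M \<omega>) \<le> f (s \<omega>) * enn2real (X \<omega> {s \<omega>})"
      using s(2)[OF elim(3)] by (simp add: F_def M_def)
    moreover have "enn2real (ennreal (f (s \<omega>)) * X \<omega> {s \<omega>}) \<le> enn2real (M \<omega>)"
      using extremal_integral_point_le[OF elim(3), of f "s \<omega>"] elim(2)
      unfolding M_def by (intro enn2real_mono) auto
    then have "f (s \<omega>) * enn2real (X \<omega> {s \<omega>}) \<le> enn2real (M \<omega>)"
      using USC_nonneg[OF f] by (simp add: enn2real_mult)
    ultimately show ?case using elim by (simp add: M_def)
  qed
  with s(1) show ?thesis by (rule that)
qed

text \<open>The case \<open>p = 1 / 2\<close> of the moment formula. One constant \<open>c\<close>
  serves all \<open>f\<close>, so it can be cancelled by normalisation.\<close>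

lemma sqrt_moment:
  obtains c where "0 < c" "\<And>f. f \<in> USC \<Longrightarrow>
    (\<integral>\<^sup>+\<omega>. ennreal (sqrt (enn2real (extremal_integral f (X \<omega>)))) \<partial>P) = ennreal (c * sqrt (ell f))"
proof -
  obtain c where c: "frechet_moment (1 / 2) = ennreal c" "0 \<le> c"
    using frechet_moment_finite[of "1 / 2"] by (cases "frechet_moment (1 / 2)") auto
  then have "0 < c" using frechet_moment_pos[of "1 / 2"] by simp
  moreover have "(\<integral>\<^sup>+\<omega>. ennreal (sqrt (enn2real (extremal_integral f (X \<omega>)))) \<partial>P) = ennreal (c * sqrt (ell f))"
    if "f \<in> USC" for f
    using frechet_scale_moment[OF frechet_scale_extremal_integral[OF that], of "1 / 2"]
      tail_dependence_nonneg[OF that] c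
    by (simp add: powr_half_sqrt ennreal_mult)
  ultimately show ?thesis by (rule that)
qed

text \<open>At a maximiser \<open>s\<close> of \<open>x \<mapsto> f x * X {x}\<close> one has, for \<open>M = extremal_integral f X\<close>,
  \<open>M + e * (g s * X {s}) \<le> extremal_integral (f + e g) X\<close>. Taking expectations of square roots, the
  right-hand side becomes \<open>c * sqrt (ell (f + e g)) \<le> c * sqrt (ell f + e * ell g)\<close>, and the measure
  below is the derivative of this inequality at \<open>e = 0\<close>.\<close>

lemma supporting_measure_exists:
  assumes f: "f \<in> USC" and pos: "0 < ell f"
  obtains \<mu> where "sets \<mu> = sets borel" "\<And>g. g \<in> USC \<Longrightarrow> (\<integral>\<^sup>+x. ennreal (g x) \<partial>\<mu>) \<le> ennreal (ell g)"
    "(\<integral>\<^sup>+x. ennreal (f x) \<partial>\<mu>) = ennreal (ell f)"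
proof -
  obtain s where s [measurable]: "s \<in> measurable P borel" and
    max: "AE \<omega> in P. 0 < extremal_integral f (X \<omega>) \<and> extremal_integral f (X \<omega>) < \<infinity> \<and>
       f (s \<omega>) * enn2real (X \<omega> {s \<omega>}) = enn2real (extremal_integral f (X \<omega>))"
    using measurable_maximiser[OF f pos] .
  obtain c where c: "0 < c" and moment: "\<And>g. g \<in> USC \<Longrightarrow>
    (\<integral>\<^sup>+\<omega>. ennreal (sqrt (enn2real (extremal_integral g (X \<omega>)))) \<partial>P) = ennreal (c * sqrt (ell g))"
    using sqrt_moment by blast
  define a where "a = ell f"
  have a: "0 < a" using pos by (simp add: a_def)
  define m where "m \<omega> = enn2real (extremal_integral f (X \<omega>))" for \<omega>
  have moment_f: "(\<integral>\<^sup>+\<omega>. ennreal (sqrt (m \<omega>)) \<partial>P) = ennreal (c * sqrt a)"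
    unfolding m_def a_def by (rule moment[OF f])
  have m0: "0 \<le> m \<omega>" for \<omega> by (simp add: m_def)
  have [measurable]: "f \<in> borel_measurable borel" using f by (rule USC_measurable)
  have [measurable]: "m \<in> borel_measurable P"
    unfolding m_def using measurable_extremal_integral[OF f] by measurable
  \<comment> \<open>Almost surely \<open>v\<close> equals \<open>X {s}\<close>; as a quotient of
    measurable functions it is visibly measurable.\<close>
  define v where "v \<omega> = m \<omega> / f (s \<omega>)" for \<omega>
  have v0: "0 \<le> v \<omega>" for \<omega> using USC_nonneg[OF f] m0 by (simp add: v_def)
  have [measurable]: "v \<in> borel_measurable P" unfolding v_def by measurable
  have max': "AE \<omega> in P. 0 < m \<omega> \<and> 0 < f (s \<omega>) \<and> m \<omega> = f (s \<omega>) * v \<omega> \<and> v \<omega> = enn2real (X \<omega> {s \<omega>})"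
    using max
  proof eventually_elim
    case (elim \<omega>)
    then have "0 < m \<omega>" by (simp add: m_def enn2real_positive_iff)
    moreover have "f (s \<omega>) \<noteq> 0" using calculation elim by (auto simp: m_def)
    moreover have eq: "m \<omega> = f (s \<omega>) * enn2real (X \<omega> {s \<omega>})"
      using elim by (simp add: m_def)
    then have "v \<omega> = enn2real (X \<omega> {s \<omega>})"
      using calculation(2) unfolding v_def eq by simp
    ultimately show ?case
      using eq USC_nonneg[OF f, of "s \<omega>"] by simp
  qed
  have deriv: "(\<integral>\<^sup>+\<omega>. ennreal (g (s \<omega>) * v \<omega> / (2 * sqrt (m \<omega>))) \<partial>P) \<le> ennreal (c * ell g / (2 * sqrt a))"
    if g: "g \<in> USC" for g
  proof -
    have [measurable]: "g \<in> borel_measurable borel" using g by (rule USC_measurable)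
    define y where "y \<omega> = g (s \<omega>) * v \<omega>" for \<omega>
    have y0: "0 \<le> y \<omega>" for \<omega> using USC_nonneg[OF g] v0 by (simp add: y_def)
    have [measurable]: "y \<in> borel_measurable P" unfolding y_def by measurable
    define b where "b = ell g"
    have b: "0 \<le> b" using g by (simp add: b_def tail_dependence_nonneg)
    \<comment> \<open>The integrand is the difference quotient of the square root at
      \<open>m\<close>, rationalised so that it is manifestly nonnegative.\<close>
    have quotient: "(\<integral>\<^sup>+\<omega>. ennreal (y \<omega> / (sqrt (m \<omega> + e * y \<omega>) + sqrt (m \<omega>))) \<partial>P)
        \<le> ennreal (c * b / (2 * sqrt a))" if e: "0 < e" for e
    proof -
      have fg: "(\<lambda>x. f x + e * g x) \<in> USC" using f USC_scale[OF g e] by (rule USC_add)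
      let ?I = "\<lambda>\<omega>. extremal_integral (\<lambda>x. f x + e * g x) (X \<omega>)"
      let ?J = "\<lambda>\<omega>. y \<omega> / (sqrt (m \<omega> + e * y \<omega>) + sqrt (m \<omega>))"
      have "ennreal (c * sqrt a) + ennreal e * (\<integral>\<^sup>+\<omega>. ennreal (?J \<omega>) \<partial>P) =
          (\<integral>\<^sup>+\<omega>. ennreal (sqrt (m \<omega>)) + ennreal e * ennreal (?J \<omega>) \<partial>P)"
        using moment_f by (simp add: nn_integral_add nn_integral_cmult)
      also have "\<dots> \<le> (\<integral>\<^sup>+\<omega>. ennreal (sqrt (enn2real (?I \<omega>))) \<partial>P)"
      proof (rule nn_integral_mono_AE)
        show "AE \<omega> in P. ennreal (sqrt (m \<omega>)) + ennreal e * ennreal (?J \<omega>) \<le> ennreal (sqrt (enn2real (?I \<omega>)))"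
          using max' frechet_scale_AE_finite[OF frechet_scale_extremal_integral[OF fg]] AE_space
        proof eventually_elim
          case (elim \<omega>)
          have "enn2real (ennreal (f (s \<omega>) + e * g (s \<omega>)) * X \<omega> {s \<omega>}) \<le> enn2real (?I \<omega>)"
            using extremal_integral_point_le[OF elim(3), of "\<lambda>x. f x + e * g x" "s \<omega>"] elim(2)
            by (intro enn2real_mono) auto
          then have "(f (s \<omega>) + e * g (s \<omega>)) * enn2real (X \<omega> {s \<omega>}) \<le> enn2real (?I \<omega>)"
            using e USC_nonneg[OF f, of "s \<omega>"] USC_nonneg[OF g, of "s \<omega>"]
            by (simp add: enn2real_mult del: ennreal_plus)
          then have le: "m \<omega> + e * y \<omega> \<le> enn2real (?I \<omega>)"
            using elim(1) by (simp add: y_def distrib_right mult.assoc)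
          have "sqrt (m \<omega> + e * y \<omega>) + sqrt (m \<omega>) > 0"
            using elim(1) y0[of \<omega>] e by (intro add_nonneg_pos) auto
          moreover have "(sqrt (m \<omega> + e * y \<omega>) - sqrt (m \<omega>)) * (sqrt (m \<omega> + e * y \<omega>) + sqrt (m \<omega>)) = e * y \<omega>"
            using elim(1) y0[of \<omega>] e by (simp add: algebra_simps)
          ultimately have "e * ?J \<omega> = sqrt (m \<omega> + e * y \<omega>) - sqrt (m \<omega>)"
            by (simp add: field_simps)
          then have "sqrt (m \<omega>) + e * ?J \<omega> \<le> sqrt (enn2real (?I \<omega>))"
            using le by simp
          moreover have J: "0 \<le> ?J \<omega>" using y0 m0 e by simp
          have "ennreal (sqrt (m \<omega>) + e * ?J \<omega>) = ennreal (sqrt (m \<omega>)) + ennreal (e * ?J \<omega>)"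
            by (rule ennreal_plus[OF _ mult_nonneg_nonneg[OF _ J]]) (use m0 e in auto)
          moreover have "ennreal (e * ?J \<omega>) = ennreal e * ennreal (?J \<omega>)"
            by (rule ennreal_mult[OF _ J]) (use e in simp)
          ultimately show ?case
            by (metis ennreal_leI)
        qed
      qed
      also have "\<dots> = ennreal (c * sqrt (ell (\<lambda>x. f x + e * g x)))" by (rule moment[OF fg])
      also have "\<dots> \<le> ennreal (c * sqrt (a + e * b))"
        using tail_dependence_subadditive[OF f USC_scale[OF g e]] tail_dependence_scale[OF g e] c
        by (intro ennreal_leI mult_left_mono) (auto simp: a_def b_def)
      finally have *: "ennreal (c * sqrt a) + ennreal e * (\<integral>\<^sup>+\<omega>. ennreal (?J \<omega>) \<partial>P) \<le> ennreal (c * sqrt (a + e * b))" .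
      \<comment> \<open>The concave square root lies below its tangent at \<open>a\<close>.\<close>
      have "sqrt (a + e * b) \<le> sqrt a + e * (b / (2 * sqrt a))"
      proof (rule real_le_lsqrt)
        have "(sqrt a + e * (b / (2 * sqrt a)))\<^sup>2 = a + e * b + (e * (b / (2 * sqrt a)))\<^sup>2"
          using a by (simp add: power2_sum)
        then show "a + e * b \<le> (sqrt a + e * (b / (2 * sqrt a)))\<^sup>2" by simp
      qed (use a b e in auto)
      then have "c * sqrt (a + e * b) \<le> c * sqrt a + e * (c * b / (2 * sqrt a))"
        using c mult_left_mono[of "sqrt (a + e * b)" "sqrt a + e * (b / (2 * sqrt a))" c]
        by (simp add: algebra_simps)
      note order_trans[OF * ennreal_leI[OF this]]
      also have "ennreal (c * sqrt a + e * (c * b / (2 * sqrt a))) =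
          ennreal (c * sqrt a) + ennreal e * ennreal (c * b / (2 * sqrt a))"
        using a b c e by (simp flip: ennreal_mult ennreal_plus)
      finally have "ennreal e * (\<integral>\<^sup>+\<omega>. ennreal (?J \<omega>) \<partial>P) \<le> ennreal e * ennreal (c * b / (2 * sqrt a))"
        by (simp add: ennreal_add_left_cancel_le)
      then show ?thesis
        using e by (subst (asm) ennreal_mult_le_mult_iff) auto
    qed
    \<comment> \<open>Letting \<open>e = 1 / Suc n\<close> tend to 0, Fatou's lemma carries the
      bound on the quotients over to the derivative.\<close>
    define u where "u n \<omega> = ennreal (y \<omega> / (sqrt (m \<omega> + 1 / real (Suc n) * y \<omega>) + sqrt (m \<omega>)))" for n \<omega>
    have [measurable]: "u n \<in> borel_measurable P" for n unfolding u_def by measurable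
    have "(\<integral>\<^sup>+\<omega>. ennreal (y \<omega> / (2 * sqrt (m \<omega>))) \<partial>P) = (\<integral>\<^sup>+\<omega>. liminf (\<lambda>n. u n \<omega>) \<partial>P)"
    proof (rule nn_integral_cong_AE)
      show "AE \<omega> in P. ennreal (y \<omega> / (2 * sqrt (m \<omega>))) = liminf (\<lambda>n. u n \<omega>)"
        using max'
      proof eventually_elim
        case (elim \<omega>)
        have "(\<lambda>n. u n \<omega>) \<longlonglongrightarrow> ennreal (y \<omega> / (sqrt (m \<omega> + 0 * y \<omega>) + sqrt (m \<omega>)))"
          unfolding u_def using elim
          by (intro tendsto_intros LIMSEQ_Suc[OF lim_1_over_n]) auto
        then show ?case
          by (intro lim_imp_Liminf[symmetric]) auto
      qed
    qed
    also have "\<dots> \<le> liminf (\<lambda>n. \<integral>\<^sup>+\<omega>. u n \<omega> \<partial>P)" by (rule nn_integral_liminf) measurable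
    also have "\<dots> \<le> liminf (\<lambda>n. ennreal (c * b / (2 * sqrt a)))"
      unfolding u_def by (intro Liminf_mono always_eventually allI quotient) simp
    also have "\<dots> = ennreal (c * b / (2 * sqrt a))" by (simp add: Liminf_const)
    finally show ?thesis by (simp add: y_def b_def)
  qed
  \<comment> \<open>The factor \<open>sqrt a / c\<close> normalises: \<open>D * f s\<close> becomes
    \<open>sqrt a / c * sqrt m\<close>, with expectation \<open>a\<close>, and the bound in
    \<open>deriv\<close> becomes exactly \<open>ell g\<close>.\<close>
  define D where "D \<omega> = sqrt a / c * (v \<omega> / sqrt (m \<omega>))" for \<omega>
  have [measurable]: "D \<in> borel_measurable P" unfolding D_def by measurable
  have D0: "0 \<le> D \<omega>" for \<omega> using a c v0 m0 by (simp add: D_def)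
  define \<mu> where "\<mu> = distr (density P (\<lambda>\<omega>. ennreal (D \<omega>))) borel s"
  have int: "(\<integral>\<^sup>+x. ennreal (g x) \<partial>\<mu>) = (\<integral>\<^sup>+\<omega>. ennreal (D \<omega> * g (s \<omega>)) \<partial>P)" if g: "g \<in> USC" for g
  proof -
    have [measurable]: "g \<in> borel_measurable borel" using g by (rule USC_measurable)
    show ?thesis unfolding \<mu>_def
      by (simp add: nn_integral_distr nn_integral_density ennreal_mult' D0)
  qed
  show ?thesis
  proof
    show "sets \<mu> = sets borel" by (simp add: \<mu>_def)
    have "(\<integral>\<^sup>+x. ennreal (f x) \<partial>\<mu>) = (\<integral>\<^sup>+\<omega>. ennreal (sqrt a / c) * ennreal (sqrt (m \<omega>)) \<partial>P)"
      unfolding int[OF f]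
    proof (rule nn_integral_cong_AE)
      show "AE \<omega> in P. ennreal (D \<omega> * f (s \<omega>)) = ennreal (sqrt a / c) * ennreal (sqrt (m \<omega>))"
        using max'
      proof eventually_elim
        case (elim \<omega>)
        then have "D \<omega> * f (s \<omega>) = sqrt a / c * (m \<omega> / sqrt (m \<omega>))" by (simp add: D_def)
        also have "m \<omega> / sqrt (m \<omega>) = sqrt (m \<omega>)" using elim by (simp add: real_div_sqrt)
        finally show ?case using a c by (simp flip: ennreal_mult')
      qed
    qed
    also have "\<dots> = ennreal (sqrt a / c) * ennreal (c * sqrt a)"
      using moment_f by (simp add: nn_integral_cmult)
    also have "\<dots> = ennreal a" using a c by (simp flip: ennreal_mult')
    finally show "(\<integral>\<^sup>+x. ennreal (f x) \<partial>\<mu>) = ennreal (ell f)" by (simp add: a_def)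
  next
    fix g :: "'a \<Rightarrow> real" assume g: "g \<in> USC"
    have [measurable]: "g \<in> borel_measurable borel" using g by (rule USC_measurable)
    have "ennreal (D \<omega> * g (s \<omega>)) =
        ennreal (2 * sqrt a / c) * ennreal (g (s \<omega>) * v \<omega> / (2 * sqrt (m \<omega>)))" for \<omega>
      using a c by (simp add: D_def mult_ac flip: ennreal_mult')
    then have "(\<integral>\<^sup>+x. ennreal (g x) \<partial>\<mu>) =
        ennreal (2 * sqrt a / c) * (\<integral>\<^sup>+\<omega>. ennreal (g (s \<omega>) * v \<omega> / (2 * sqrt (m \<omega>))) \<partial>P)"
      unfolding int[OF g] by (simp add: nn_integral_cmult)
    also have "\<dots> \<le> ennreal (2 * sqrt a / c) * ennreal (c * ell g / (2 * sqrt a))"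
      by (intro mult_left_mono deriv g) simp
    also have "\<dots> = ennreal (ell g)"
      using a c by (simp flip: ennreal_mult')
    finally show "(\<integral>\<^sup>+x. ennreal (g x) \<partial>\<mu>) \<le> ennreal (ell g)" .
  qed
qed

end

section \<open>Convex combinations of measures\<close>

lemma sets_convex_comb_measure: "sets (convex_comb_measure t \<mu> \<nu>) = sets borel"
  using sets.sigma_sets_eq[of borel] by (simp add: convex_comb_measure_def)

lemma emeasure_convex_comb_measure:
  assumes \<mu>: "sets \<mu> = sets borel" and \<nu>: "sets \<nu> = sets borel" and A: "A \<in> sets borel"
  shows "emeasure (convex_comb_measure t \<mu> \<nu>) A = ennreal t * emeasure \<mu> A + ennreal (1 - t) * emeasure \<nu> A"
proof (rule emeasure_measure_of[OF convex_comb_measure_def])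
  show "countably_additive (sets (convex_comb_measure t \<mu> \<nu>))
     (\<lambda>A. ennreal t * emeasure \<mu> A + ennreal (1 - t) * emeasure \<nu> A)"
  proof (rule countably_additiveI)
    fix B :: "nat \<Rightarrow> 'a set"
    assume "range B \<subseteq> sets (convex_comb_measure t \<mu> \<nu>)" "disjoint_family B"
    then show "(\<Sum>i. ennreal t * emeasure \<mu> (B i) + ennreal (1 - t) * emeasure \<nu> (B i)) =
        ennreal t * emeasure \<mu> (\<Union> (range B)) + ennreal (1 - t) * emeasure \<nu> (\<Union> (range B))"
      by (subst suminf_add[symmetric]) (auto simp: sets_convex_comb_measure \<mu> \<nu> suminf_emeasure)
  qed
qed (use A in \<open>auto simp: positive_def sets_convex_comb_measure\<close>)

text \<open>Induction over nonnegative measurable functions; in the limit step the sum of suprema is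
  a supremum of sums since both sequences increase.\<close>

lemma nn_integral_convex_comb_measure:
  assumes \<mu>: "sets \<mu> = sets borel" and \<nu>: "sets \<nu> = sets borel" and f: "f \<in> borel_measurable borel"
  shows "(\<integral>\<^sup>+x. f x \<partial>convex_comb_measure t \<mu> \<nu>) =
    ennreal t * (\<integral>\<^sup>+x. f x \<partial>\<mu>) + ennreal (1 - t) * (\<integral>\<^sup>+x. f x \<partial>\<nu>)"
proof -
  note s = measurable_cong_sets[OF \<mu> refl] measurable_cong_sets[OF \<nu> refl]
    measurable_cong_sets[OF sets_convex_comb_measure refl]
  show ?thesis
    using f
  proof (induction rule: borel_measurable_induct)
    case (cong f g)
    then have "f = g" by (auto simp: fun_eq_iff)
    with cong show ?case by simp
  next
    case (set A)
    then show ?case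
      by (simp add: \<mu> \<nu> sets_convex_comb_measure emeasure_convex_comb_measure)
  next
    case (mult u c)
    then show ?case by (simp add: nn_integral_cmult s algebra_simps distrib_left)
  next
    case (add u v)
    then show ?case by (simp add: nn_integral_add s distrib_left add_ac)
  next
    case (seq U)
    have SUP: "(\<integral>\<^sup>+x. (SUP i. U i) x \<partial>N) = (SUP i. \<integral>\<^sup>+x. U i x \<partial>N)"
      if "sets N = sets borel" for N
    proof -
      have "U i \<in> borel_measurable N" for i
        using seq(1) by (simp add: measurable_cong_sets[OF that refl])
      then show ?thesis
        unfolding SUP_apply using seq(3) by (intro nn_integral_monotone_convergence_SUP)
    qed
    have "incseq (\<lambda>i. \<integral>\<^sup>+x. U i x \<partial>N)" for N
      using seq(3) by (auto simp: incseq_def le_fun_def intro!: nn_integral_mono)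
    then have "incseq (\<lambda>i. r * (\<integral>\<^sup>+x. U i x \<partial>N))" for r N
      by (auto simp: incseq_def intro!: mult_left_mono)
    then show ?case
      unfolding SUP[OF \<mu>] SUP[OF \<nu>] SUP[OF sets_convex_comb_measure]
      by (simp add: seq.IH SUP_mult_left_ennreal ennreal_SUP_add)
  qed
qed

section \<open>Convexity of the dominated measures and the supremum representation of the tail
  dependence functional\<close>

theorem mainTheorem11:
  fixes P :: "'w measure"
    and X :: "'w \<Rightarrow> ('a::{t2_space, second_countable_topology}) set \<Rightarrow> ennreal"
    and \<M> :: "'a measure set"
  assumes "locally_compact_space (euclidean :: 'a topology)"
    and "random_sup_measure P X"
    and "max_stable P X"
    and "\<M> = {\<mu>. radon_measure \<mu> \<and>
                 (\<forall>f\<in>USC. (\<integral>\<^sup>+ x. ennreal (f x) \<partial>\<mu>) \<le> ennreal (tail_dependence P X f))}"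
  shows "(\<forall>\<mu>\<in>\<M>. \<forall>\<nu>\<in>\<M>. \<forall>t\<in>{0..1}. convex_comb_measure t \<mu> \<nu> \<in> \<M>) \<and>
         (\<forall>f\<in>USC. ennreal (tail_dependence P X f) = (SUP \<mu>\<in>\<M>. \<integral>\<^sup>+ x. ennreal (f x) \<partial>\<mu>))"
proof -
  \<comment> \<open>The whole space is exactly the set of sup-measures, so measurability of
    \<open>X\<close> makes \<open>X \<omega>\<close> a sup-measure for every outcome in
    \<open>space P\<close>.\<close>
  have topspace: "topspace sup_vague_topology = (sup_measures :: ('a set \<Rightarrow> ennreal) set)"
    unfolding sup_vague_topology_def topology_generated_by_topspace by blast
  then have "space sup_vague_borel = (sup_measures :: ('a set \<Rightarrow> ennreal) set)"
    unfolding sup_vague_borel_def by (subst space_measure_of) (auto dest: openin_subset)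
  moreover have "prob_space P" and "X \<in> measurable P sup_vague_borel"
    using assms(2) by (auto simp: random_sup_measure_def)
  ultimately interpret max_stable_sup_measure P X
    using assms(1,3) measurable_space[of X P sup_vague_borel]
    by (intro max_stable_sup_measure.intro max_stable_sup_measure_axioms.intro)
      (auto simp: sup_measures_def)
  \<comment> \<open>Indicators of compact sets belong to \<open>USC\<close>, so domination by
    \<open>ell\<close> already gives finiteness on compacts.\<close>
  have dominated: "\<mu> \<in> \<M>" if \<mu>: "sets \<mu> = sets borel"
    "\<And>g. g \<in> USC \<Longrightarrow> (\<integral>\<^sup>+ x. ennreal (g x) \<partial>\<mu>) \<le> ennreal (ell g)" for \<mu>
  proof -
    have "emeasure \<mu> K < \<infinity>" if K: "compact K" for K
    proof -
      have "emeasure \<mu> K = (\<integral>\<^sup>+ x. ennreal (indicator K x) \<partial>\<mu>)"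
        using \<mu>(1) borel_compact[OF K] by (simp add: ennreal_indicator)
      also have "\<dots> \<le> ennreal (ell (indicator K))"
        by (rule \<mu>(2)[OF indicator_compact_in_USC[OF K]])
      finally show ?thesis by (rule le_less_trans) simp
    qed
    then show ?thesis using \<mu> by (simp add: assms(4) radon_measure_def)
  qed
  have sets_M: "sets \<mu> = sets borel" and le_M: "\<And>g. g \<in> USC \<Longrightarrow> (\<integral>\<^sup>+ x. ennreal (g x) \<partial>\<mu>) \<le> ennreal (ell g)"
    if "\<mu> \<in> \<M>" for \<mu>
    using that by (auto simp: assms(4) radon_measure_def)
  have "convex_comb_measure t \<mu> \<nu> \<in> \<M>" if "\<mu> \<in> \<M>" "\<nu> \<in> \<M>" "t \<in> {0..1}" for \<mu> \<nu> t
  proof (rule dominated[OF sets_convex_comb_measure])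
    fix g :: "'a \<Rightarrow> real" assume g: "g \<in> USC"
    have "(\<integral>\<^sup>+ x. ennreal (g x) \<partial>convex_comb_measure t \<mu> \<nu>) =
      ennreal t * (\<integral>\<^sup>+x. ennreal (g x) \<partial>\<mu>) + ennreal (1 - t) * (\<integral>\<^sup>+x. ennreal (g x) \<partial>\<nu>)"
      using sets_M that USC_measurable[OF g] by (intro nn_integral_convex_comb_measure) auto
    also have "\<dots> \<le> ennreal t * ennreal (ell g) + ennreal (1 - t) * ennreal (ell g)"
      by (intro add_mono mult_left_mono le_M that g) simp_all
    also have "\<dots> = ennreal (t * ell g + (1 - t) * ell g)"
      using that(3) tail_dependence_nonneg[OF g] by (simp flip: ennreal_mult ennreal_plus)
    also have "t * ell g + (1 - t) * ell g = ell g" by (simp add: algebra_simps)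
    finally show "(\<integral>\<^sup>+ x. ennreal (g x) \<partial>convex_comb_measure t \<mu> \<nu>) \<le> ennreal (ell g)" .
  qed
  moreover have "ennreal (ell f) = (SUP \<mu>\<in>\<M>. \<integral>\<^sup>+ x. ennreal (f x) \<partial>\<mu>)" if f: "f \<in> USC" for f
  proof (rule antisym)
    show "ennreal (ell f) \<le> (SUP \<mu>\<in>\<M>. \<integral>\<^sup>+ x. ennreal (f x) \<partial>\<mu>)"
    \<comment> \<open>A supporting measure is constructed only for \<open>ell f > 0\<close>; for
      \<open>ell f = 0\<close> the inequality is trivial.\<close>
    proof (cases "ell f = 0")
      case False
      then have "0 < ell f" using tail_dependence_nonneg[OF f] by simp
      from supporting_measure_exists[OF f this] obtain \<mu> where \<mu>: "sets \<mu> = sets borel"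
        "\<And>g. g \<in> USC \<Longrightarrow> (\<integral>\<^sup>+x. ennreal (g x) \<partial>\<mu>) \<le> ennreal (ell g)"
        "(\<integral>\<^sup>+x. ennreal (f x) \<partial>\<mu>) = ennreal (ell f)" by blast
      from dominated[OF \<mu>(1,2)] show ?thesis
        unfolding \<mu>(3)[symmetric] by (rule SUP_upper)
    qed simp
  qed (auto intro: SUP_least le_M f)
  ultimately show ?thesis by blast
qed

end
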